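(* Let $\mathbb{K}$ be a field, $S=\mathbb{K}[x_1,\ldots,x_n]$, and let $I\subseteq S$ be a support-$2$ monomial ideal such that the irreducible decomposition of $I$ is minimal and $I$ has no embedded associated primes. Then $I$ is a Simis ideal if and only if $G(I)$ is a bipartite graph and $I$ has a standard linear weighting. In particular, if such an $I$ is a Simis ideal, then there exist a Simis square-free monomial ideal $J\subseteq S$ and a standard linear weighting $w$ of $S$ such that $I=J_w$.
   Context: For a monomial ideal $I$, $\mathcal{G}(I)$ denotes its unique minimal set of monomial generators. $I$ is a support-$2$ monomial ideal if $\mathcal{G}(I)\subseteq\{x_i^ax_j^b : 1\le i<j\le n,\ a,b\ge 1\}$. The underlying simple graph $G(I)$ has vertices $x_1,\ldots,x_n$ and an edge $\{x_i,x_j\}$ whenever some element of $\mathcal{G}(I)$ has support $\{x_i,x_j\}$; thus $\sqrt{I}$ is the edge ideal $I(G(I))=\langle x_ix_j:\{x_i,x_j\}\in E(G(I))\rangle$. The $s$-th symbolic power is $I^{(s)}=\bigcap_{P\in \mathrm{MinAss}(I)}(I^sS_P\cap S)$, where $\mathrm{MinAss}(I)$ is the set of minimal primes of $I$; for monomial $I$ this equals $\bigcap_{P\in\mathrm{MinAss}(I)}Q(P)^s$ with $Q(P)$ the $P$-primary component of $I$. $I$ is a Simis ideal if $I^{(s)}=I^s$ for all $s\ge1$. An ideal is irreducible if it is not an intersection of two strictly larger ideals; irreducible monomial ideals are those generated by pure powers of variables, and every monomial ideal has a unique irredundant decomposition as an intersection of irreducible monomial ideals. This irreducible decomposition $I=\bigcap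 Q_i$ is called minimal if $\sqrt{Q_i}\neq\sqrt{Q_j}$ for $i\ne j$. A standard linear weighting of $S$ is a map $w:\mathbb{R}^n\to\mathbb{R}^n$, $w(a_1,\ldots,a_n)=(d_1a_1,\ldots,d_na_n)$ for fixed positive integers $d_1,\ldots,d_n$; for a monomial ideal $J$, $J_w$ is the ideal generated by the monomials $\mathbf{x}^{w(\mathbf{a})}$ for $\mathbf{x}^{\mathbf{a}}\in\mathcal{G}(J)$ (i.e., replace each $x_i$ by $x_i^{d_i}$ in the generators). "$I$ has a standard linear weighting" means $I=(\sqrt{I})_w$ for some standard linear weighting $w$. *)

theory Defs
  imports Main "HOL-Library.Poly_Mapping"
begin

text \<open>The polynomial ring S = K[x_i : i in 'n] over a field K, with 'n a finite type
  (n = CARD('n) variables).  An exponent vector is a finitely supported map 'n to nat;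
  a polynomial is a finitely supported map from exponent vectors to coefficients
  (multiplication is convolution, from HOL-Library.Poly_Mapping).\<close>

type_synonym ('n, 'k) mpoly = "('n \<Rightarrow>\<^sub>0 nat) \<Rightarrow>\<^sub>0 'k"

definition monom :: "('n \<Rightarrow>\<^sub>0 nat) \<Rightarrow> ('n, 'k::comm_ring_1) mpoly" where
  "monom a = Poly_Mapping.single a 1"

definition mdvd :: "('n \<Rightarrow>\<^sub>0 nat) \<Rightarrow> ('n \<Rightarrow>\<^sub>0 nat) \<Rightarrow> bool" where
  "mdvd a b \<longleftrightarrow> (\<forall>i. Poly_Mapping.lookup a i \<le> Poly_Mapping.lookup b i)"

definition is_ideal :: "'a::comm_ring_1 set \<Rightarrow> bool" where
  "is_ideal I \<longleftrightarrow> 0 \<in> I \<and> (\<forall>a\<in>I. \<forall>b\<in>I. a + b \<in> I) \<and> (\<forall>r. \<forall>a\<in>I. r * a \<in> I)"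

definition ideal_gen :: "'a::comm_ring_1 set \<Rightarrow> 'a set" where
  "ideal_gen A = \<Inter>{I. is_ideal I \<and> A \<subseteq> I}"

fun ideal_pow :: "'a::comm_ring_1 set \<Rightarrow> nat \<Rightarrow> 'a set" where
  "ideal_pow I 0 = UNIV"
| "ideal_pow I (Suc s) = ideal_gen {f * g | f g. f \<in> I \<and> g \<in> ideal_pow I s}"

definition radical :: "'a::comm_ring_1 set \<Rightarrow> 'a set" where
  "radical I = {f. \<exists>k. f ^ k \<in> I}"

definition prime_ideal :: "'a::comm_ring_1 set \<Rightarrow> bool" where
  "prime_ideal P \<longleftrightarrow> is_ideal P \<and> 1 \<notin> P \<and> (\<forall>a b. a * b \<in> P \<longrightarrow> a \<in> P \<or> b \<in> P)"

definition Ass :: "'a::comm_ring_1 set \<Rightarrow> 'a set set" where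
  "Ass I = {P. prime_ideal P \<and> (\<exists>f. P = {g. g * f \<in> I})}"

definition MinAss :: "'a::comm_ring_1 set \<Rightarrow> 'a set set" where
  "MinAss I = {P. prime_ideal P \<and> I \<subseteq> P \<and>
      \<not> (\<exists>Q. prime_ideal Q \<and> I \<subseteq> Q \<and> Q \<subset> P)}"

text \<open>Symbolic power: intersection over minimal primes P of I^s S_P \<inter> S.\<close>
definition symb_pow :: "'a::comm_ring_1 set \<Rightarrow> nat \<Rightarrow> 'a set" where
  "symb_pow I s = (\<Inter>P\<in>MinAss I. {f. \<exists>g. g \<notin> P \<and> g * f \<in> ideal_pow I s})"

definition simis :: "'a::comm_ring_1 set \<Rightarrow> bool" where
  "simis I \<longleftrightarrow> (\<forall>s\<ge>1. symb_pow I s = ideal_pow I s)"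

definition monomial_ideal :: "('n, 'k::comm_ring_1) mpoly set \<Rightarrow> bool" where
  "monomial_ideal I \<longleftrightarrow> (\<exists>M. I = ideal_gen (monom ` M))"

definition mingens :: "('n, 'k::comm_ring_1) mpoly set \<Rightarrow> ('n \<Rightarrow>\<^sub>0 nat) set" where
  "mingens I = {a. monom a \<in> I \<and> \<not> (\<exists>b. monom b \<in> I \<and> b \<noteq> a \<and> mdvd b a)}"

definition support2 :: "('n, 'k::comm_ring_1) mpoly set \<Rightarrow> bool" where
  "support2 I \<longleftrightarrow> (\<forall>a\<in>mingens I. \<exists>i j. i \<noteq> j \<and> Poly_Mapping.keys a = {i, j})"

definition graph_edges :: "('n, 'k::comm_ring_1) mpoly set \<Rightarrow> 'n set set" where
  "graph_edges I = Poly_Mapping.keys ` mingens I"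

definition bipartite :: "'n set set \<Rightarrow> bool" where
  "bipartite E \<longleftrightarrow> (\<exists>A. \<forall>e\<in>E. \<exists>u v. e = {u, v} \<and> u \<in> A \<and> v \<notin> A)"

definition squarefree_monomial_ideal :: "('n, 'k::comm_ring_1) mpoly set \<Rightarrow> bool" where
  "squarefree_monomial_ideal J \<longleftrightarrow> monomial_ideal J \<and> (\<forall>a\<in>mingens J. \<forall>i. Poly_Mapping.lookup a i \<le> 1)"

definition std_weighting :: "('n \<Rightarrow> nat) \<Rightarrow> bool" where
  "std_weighting d \<longleftrightarrow> (\<forall>i. d i > 0)"

definition wvec :: "('n \<Rightarrow> nat) \<Rightarrow> ('n \<Rightarrow>\<^sub>0 nat) \<Rightarrow> ('n \<Rightarrow>\<^sub>0 nat)" where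
  "wvec d a = Poly_Mapping.mapp (\<lambda>i v. d i * v) a"

definition weighted :: "('n \<Rightarrow> nat) \<Rightarrow> ('n, 'k::comm_ring_1) mpoly set \<Rightarrow> ('n, 'k) mpoly set" where
  "weighted d J = ideal_gen (monom ` wvec d ` mingens J)"

definition has_std_weighting :: "('n, 'k::comm_ring_1) mpoly set \<Rightarrow> bool" where
  "has_std_weighting I \<longleftrightarrow> (\<exists>d. std_weighting d \<and> I = weighted d (radical I))"

definition irreducible_ideal :: "'a::comm_ring_1 set \<Rightarrow> bool" where
  "irreducible_ideal Q \<longleftrightarrow> is_ideal Q \<and> Q \<noteq> UNIV \<and>
     \<not> (\<exists>A B. is_ideal A \<and> is_ideal B \<and> Q \<subset> A \<and> Q \<subset> B \<and> Q = A \<inter> B)"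

definition irr_decomp :: "('n, 'k::comm_ring_1) mpoly set \<Rightarrow> ('n, 'k) mpoly set set \<Rightarrow> bool" where
  "irr_decomp I \<Q> \<longleftrightarrow> finite \<Q> \<and> (\<forall>Q\<in>\<Q>. monomial_ideal Q \<and> irreducible_ideal Q) \<and>
     I = \<Inter>\<Q> \<and> (\<forall>Q\<in>\<Q>. \<Inter>(\<Q> - {Q}) \<noteq> I)"

definition minimal_irr_decomp :: "('n, 'k::comm_ring_1) mpoly set \<Rightarrow> bool" where
  "minimal_irr_decomp I \<longleftrightarrow> (\<forall>\<Q>. irr_decomp I \<Q> \<longrightarrow>
     (\<forall>Q1\<in>\<Q>. \<forall>Q2\<in>\<Q>. Q1 \<noteq> Q2 \<longrightarrow> radical Q1 \<noteq> radical Q2))"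

end

theory Submission
  imports Defs Complex_Main
begin

text \<open>Let \<open>M\<close> be the set of exponents of the minimal generators. The minimal primes of \<open>I\<close> belong to
  the minimal vertex covers \<open>C\<close>, and minimality of the irreducible decomposition makes the
  localisation of \<open>I\<close> at such a prime a power ideal \<open>(x i ^ a C i : i \<in> C)\<close>. If \<open>I\<close> is Simis, its Newton
  polyhedron therefore equals the polyhedron of the inequalities \<open>(\<Sum>i\<in>C. u i / a C i) \<ge> 1\<close>. So for
  a weight \<open>w \<ge> 0\<close> with \<open>w \<bullet> g \<ge> 1\<close> on \<open>M\<close>, some \<open>C\<close> avoids the zeros of \<open>w\<close> and attains equality at
  every \<open>g\<close> with \<open>w \<bullet> g = 1\<close>; such a \<open>g\<close> has exactly one end \<open>i\<close> in \<open>C\<close>, with exponent \<open>a C i\<close>. Suitable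
  weights \<open>w\<close> show in turn that every edge carries one generator, that there are no triangles,
  that all generators have the same exponent \<open>d i\<close> at \<open>i\<close>, and, with \<open>w i = 1 / (2 * d i)\<close>, that
  the graph is bipartite. The converse is a weighted Koenig theorem.\<close>

text \<open>Primes, denominators in \<open>symb_pow\<close> and the ideals in
  \<open>irreducible_ideal\<close> range over arbitrary polynomials, whereas the argument lives on
  exponent vectors. The obstacle in between is cancellation; it is controlled by the terms of least
  degree in the variables of a set \<open>C\<close>, and among these by a sum of exponents attained
  only once.

  One cover serves a whole face because it is found at the sum of the generators of that face: an
  inequality tight at the sum is tight at each summand. A tight generator has the least possible
  exponent \<open>a C i\<close> at its only end \<open>i\<close> in \<open>C\<close>. So two tight
  generators meeting \<open>C\<close> in the same vertex agree there, and tight edges cannot close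
  up to an odd cycle. All contradictions are of these two kinds. The weights that lead to them equal
  1 away from the two or three vertices in question, which makes every generator reaching beyond
  those vertices satisfy its inequality for free.\<close>

abbreviation lookup :: "('a \<Rightarrow>\<^sub>0 'b::zero) \<Rightarrow> 'a \<Rightarrow> 'b" where
  "lookup \<equiv> Poly_Mapping.lookup"

abbreviation keys :: "('a \<Rightarrow>\<^sub>0 'b::zero) \<Rightarrow> 'a set" where
  "keys \<equiv> Poly_Mapping.keys"

abbreviation single :: "'a \<Rightarrow> 'b \<Rightarrow> ('a \<Rightarrow>\<^sub>0 'b::zero)" where
  "single \<equiv> Poly_Mapping.single"

section \<open>Exponent vectors\<close>

definition expvec :: "('n::finite \<Rightarrow> nat) \<Rightarrow> ('n \<Rightarrow>\<^sub>0 nat)" where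
  "expvec f = Abs_poly_mapping f"

lemma lookup_expvec [simp]: "lookup (expvec f) = f"
  unfolding expvec_def by (rule lookup_Abs_poly_mapping) simp

lemma keys_expvec [simp]: "keys (expvec f) = {i. f i \<noteq> 0}"
  by (auto simp: in_keys_iff)

lemma mdvd_refl [simp]: "mdvd a a"
  by (simp add: mdvd_def)

lemma mdvd_trans: "mdvd a b \<Longrightarrow> mdvd b c \<Longrightarrow> mdvd a c"
  unfolding mdvd_def using order_trans by blast

lemma mdvd_antisym: "mdvd a b \<Longrightarrow> mdvd b a \<Longrightarrow> a = b"
  unfolding mdvd_def by (intro poly_mapping_eqI antisym) auto

lemma mdvd_add_right [simp]: "mdvd a (a + b)"
  by (simp add: mdvd_def lookup_add)

lemma mdvd_imp_add:
  assumes "mdvd a b"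
  shows "b = a + (b - a)"
  using assms by (intro poly_mapping_eqI) (simp add: mdvd_def lookup_add lookup_minus)

lemma keys_add_nat [simp]: "keys (a + b :: 'n \<Rightarrow>\<^sub>0 nat) = keys a \<union> keys b"
  by (auto simp: in_keys_iff lookup_add)

section \<open>Polynomials\<close>

lemma poly_sum_single: "(\<Sum>a\<in>keys f. single a (lookup f a)) = f"
  by (intro poly_mapping_eqI)
    (auto simp: lookup_sum lookup_single when_def in_keys_iff)

lemma monom_mult: "monom a * monom b = monom (a + b)"
  by (simp add: monom_def mult_single)

lemma monom_zero [simp]: "monom 0 = 1"
  by (simp add: monom_def)

lemma keys_monom [simp]: "keys (monom a :: ('n, 'k::field) mpoly) = {a}"
  by (simp add: monom_def)

lemma monom_power: "monom a ^ k = monom (\<Sum>i<k. a)"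
  by (induction k) (simp_all add: monom_mult add.commute del: sum_constant)

lemma single_mult_monom: "single 0 c * monom a = single a c"
  by (simp add: monom_def mult_single)

lemma lookup_mult_double_sum:
  fixes f g :: "('n, 'k::field) mpoly"
  shows "lookup (f * g) c =
    (\<Sum>a\<in>keys f. \<Sum>b\<in>keys g. if a + b = c then lookup f a * lookup g b else 0)"
proof -
  have "f * g = (\<Sum>a\<in>keys f. single a (lookup f a)) * (\<Sum>b\<in>keys g. single b (lookup g b))"
    by (simp add: poly_sum_single)
  also have "\<dots> = (\<Sum>a\<in>keys f. \<Sum>b\<in>keys g. single (a + b) (lookup f a * lookup g b))"
    by (simp add: sum_product mult_single)
  finally show ?thesis
    by (simp add: lookup_sum lookup_single when_def)
qed

lemma lookup_monom_mult:
  fixes f :: "('n, 'k::field) mpoly"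
  shows "lookup (monom t * f) (t + c) = lookup f c"
proof -
  have "lookup (monom t * f) (t + c) = (\<Sum>b\<in>keys f. if b = c then lookup f b else 0)"
    by (simp add: lookup_mult_double_sum) (simp add: monom_def)
  also have "\<dots> = lookup f c"
    by (auto simp: in_keys_iff)
  finally show ?thesis .
qed

lemma keys_multE:
  assumes "c \<in> keys (f * g)"
  obtains a b where "a \<in> keys f" "b \<in> keys g" "c = a + b"
  using assms keys_mult[of f g] by blast

section \<open>Ideals spanned by monomials\<close>

lemma is_ideal_sum:
  assumes "is_ideal I" "\<And>x. x \<in> A \<Longrightarrow> f x \<in> I"
  shows "sum f A \<in> I"
  using assms(2)
proof (induction A rule: infinite_finite_induct)
  case (insert x F)
  then show ?case using assms(1) by (simp add: is_ideal_def)
qed (use assms(1) in \<open>auto simp: is_ideal_def\<close>)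

lemma is_ideal_diff:
  assumes "is_ideal I" "a \<in> I" "b \<in> I"
  shows "a - b \<in> I"
proof -
  have "(-1) * b \<in> I" using assms unfolding is_ideal_def by blast
  then have "a + (-1) * b \<in> I" using assms unfolding is_ideal_def by blast
  then show ?thesis by simp
qed

lemma ideal_gen_least: "is_ideal I \<Longrightarrow> A \<subseteq> I \<Longrightarrow> ideal_gen A \<subseteq> I"
  by (auto simp: ideal_gen_def)

lemma ideal_gen_superset: "A \<subseteq> ideal_gen A"
  by (auto simp: ideal_gen_def)

lemma is_ideal_ideal_gen: "is_ideal (ideal_gen A)"
  by (auto simp: ideal_gen_def is_ideal_def)

definition upset :: "('n \<Rightarrow>\<^sub>0 nat) set \<Rightarrow> bool" where
  "upset U \<longleftrightarrow> (\<forall>a b. a \<in> U \<longrightarrow> a + b \<in> U)"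

definition upc :: "('n \<Rightarrow>\<^sub>0 nat) set \<Rightarrow> ('n \<Rightarrow>\<^sub>0 nat) set" where
  "upc M = {a. \<exists>m\<in>M. mdvd m a}"

text \<open>For \<open>U\<close> closed upwards this is the monomial ideal with exponent set
  \<open>U\<close>. Membership is tested term by term, so inclusions and intersections of ideals
  become those of exponent sets.\<close>

definition mideal :: "('n \<Rightarrow>\<^sub>0 nat) set \<Rightarrow> ('n, 'k::field) mpoly set" where
  "mideal U = {f. keys f \<subseteq> U}"

lemma upsetD: "upset U \<Longrightarrow> a \<in> U \<Longrightarrow> mdvd a b \<Longrightarrow> b \<in> U"
  using mdvd_imp_add unfolding upset_def by metis

lemma upset_add_left: "upset U \<Longrightarrow> b \<in> U \<Longrightarrow> a + b \<in> U"
  unfolding upset_def by (metis add.commute)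

lemma upset_upc: "upset (upc M)"
  using mdvd_trans mdvd_add_right unfolding upset_def upc_def by blast

lemma subset_upc: "M \<subseteq> upc M"
  using mdvd_refl unfolding upc_def by blast

lemma upc_upset: "upset U \<Longrightarrow> upc U = U"
  using upsetD subset_upc unfolding upc_def by blast

lemma monom_in_mideal [simp]: "(monom a :: ('n, 'k::field) mpoly) \<in> mideal U \<longleftrightarrow> a \<in> U"
  by (simp add: mideal_def)

lemma is_ideal_mideal:
  assumes "upset U"
  shows "is_ideal (mideal U :: ('n, 'k::field) mpoly set)"
  unfolding is_ideal_def
proof (intro conjI allI ballI)
  fix f g :: "('n, 'k) mpoly"
  assume "f \<in> mideal U" "g \<in> mideal U"
  then show "f + g \<in> mideal U"
    using Poly_Mapping.keys_add[of f g] by (auto simp: mideal_def)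
next
  fix r f :: "('n, 'k) mpoly"
  assume "f \<in> mideal U"
  then show "r * f \<in> mideal U"
    using upset_add_left[OF assms] by (auto simp: mideal_def elim!: keys_multE)
qed (simp add: mideal_def)

lemma mideal_least:
  fixes I :: "('n, 'k::field) mpoly set"
  assumes "is_ideal I" and "monom ` U \<subseteq> I"
  shows "mideal U \<subseteq> I"
proof
  fix f :: "('n, 'k) mpoly"
  assume f: "f \<in> mideal U"
  have "(\<Sum>a\<in>keys f. single a (lookup f a)) \<in> I"
  proof (rule is_ideal_sum[OF assms(1)])
    fix a assume "a \<in> keys f"
    then have "monom a \<in> I" using f assms(2) by (auto simp: mideal_def)
    then have "single 0 (lookup f a) * monom a \<in> I"
      using assms(1) unfolding is_ideal_def by blast
    then show "single a (lookup f a) \<in> I" by (simp add: single_mult_monom)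
  qed
  then show "f \<in> I" by (simp add: poly_sum_single)
qed

lemma ideal_gen_monom:
  "ideal_gen (monom ` M :: ('n, 'k::field) mpoly set) = mideal (upc M)"
proof
  show "ideal_gen (monom ` M :: ('n, 'k) mpoly set) \<subseteq> mideal (upc M)"
    using subset_upc[of M] by (intro ideal_gen_least is_ideal_mideal upset_upc) auto
  show "mideal (upc M) \<subseteq> ideal_gen (monom ` M :: ('n, 'k) mpoly set)"
  proof (rule mideal_least[OF is_ideal_ideal_gen], safe)
    fix a assume "a \<in> upc M"
    then obtain m where m: "m \<in> M" "mdvd m a" by (auto simp: upc_def)
    have "monom (a - m) * (monom m :: ('n, 'k) mpoly) \<in> ideal_gen (monom ` M)"
      using is_ideal_ideal_gen[of "monom ` M"] ideal_gen_superset[of "monom ` M"] m(1)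
      unfolding is_ideal_def by blast
    then show "monom a \<in> (ideal_gen (monom ` M) :: ('n, 'k) mpoly set)"
      using mdvd_imp_add[OF m(2)] by (simp add: monom_mult add.commute)
  qed
qed

section \<open>Powers of monomial ideals in terms of exponents\<close>

fun upow :: "('n \<Rightarrow>\<^sub>0 nat) set \<Rightarrow> nat \<Rightarrow> ('n \<Rightarrow>\<^sub>0 nat) set" where
  "upow U 0 = UNIV"
| "upow U (Suc s) = {a + b | a b. a \<in> U \<and> b \<in> upow U s}"

lemma upset_upow: "upset (upow U s)"
proof (induction s)
  case (Suc s)
  then show ?case unfolding upset_def by (auto simp: add.assoc) blast
qed (simp add: upset_def)

lemma ideal_pow_mideal:
  "ideal_pow (mideal U :: ('n, 'k::field) mpoly set) s = mideal (upow U s)"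
proof (induction s)
  case (Suc s)
  let ?P = "{f * g | f g. f \<in> mideal U \<and> g \<in> (mideal (upow U s) :: ('n, 'k) mpoly set)}"
  have "ideal_gen ?P \<subseteq> mideal (upow U (Suc s))"
  proof (rule ideal_gen_least[OF is_ideal_mideal[OF upset_upow]], safe)
    fix f g :: "('n, 'k) mpoly"
    assume "f \<in> mideal U" "g \<in> mideal (upow U s)"
    then show "f * g \<in> mideal (upow U (Suc s))"
      by (fastforce simp: mideal_def elim!: keys_multE)
  qed
  moreover have "mideal (upow U (Suc s)) \<subseteq> ideal_gen ?P"
  proof (rule mideal_least[OF is_ideal_ideal_gen], safe)
    fix c assume "c \<in> upow U (Suc s)"
    then obtain a b where ab: "c = a + b" "a \<in> U" "b \<in> upow U s" by auto
    have "monom c = (monom a :: ('n, 'k) mpoly) * monom b"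
      by (simp add: ab(1) monom_mult)
    then have "monom c \<in> ?P"
      using ab(2,3) monom_in_mideal by blast
    then show "monom c \<in> ideal_gen ?P"
      by (rule subsetD[OF ideal_gen_superset])
  qed
  ultimately show ?case using Suc by simp
qed (simp add: mideal_def)

lemma upow_add: "a \<in> upow U s \<Longrightarrow> b \<in> upow U t \<Longrightarrow> a + b \<in> upow U (s + t)"
proof (induction s arbitrary: a)
  case 0
  then show ?case using upset_add_left[OF upset_upow] by simp
next
  case (Suc s)
  then show ?case by (auto simp: add.assoc) blast
qed

lemma upow_antimono:
  assumes "s \<le> t"
  shows "upow U t \<subseteq> upow U s"
proof
  fix a assume a: "a \<in> upow U t"
  from assms show "a \<in> upow U s"
    using a
  proof (induction t arbitrary: a rule: dec_induct)
    case (step t)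
    then obtain b c where "a = b + c" "c \<in> upow U t" by auto
    then show ?case
      using step.IH[of c] upset_add_left[OF upset_upow] by blast
  qed
qed

lemma upow_scale:
  assumes "a \<in> U"
  shows "expvec (\<lambda>v. k * lookup a v) \<in> upow U k"
proof (induction k)
  case (Suc k)
  have "expvec (\<lambda>v. Suc k * lookup a v) = a + expvec (\<lambda>v. k * lookup a v)"
    by (intro poly_mapping_eqI) (simp add: lookup_add)
  then show ?case using Suc assms by auto
qed simp

lemma upow_sum:
  assumes "finite C" "\<And>i. i \<in> C \<Longrightarrow> \<gamma> i \<in> U"
  shows "expvec (\<lambda>v. \<Sum>i\<in>C. k i * lookup (\<gamma> i) v) \<in> upow U (\<Sum>i\<in>C. k i)"
  using assms
proof (induction C)
  case (insert j C)
  have "expvec (\<lambda>v. \<Sum>i\<in>insert j C. k i * lookup (\<gamma> i) v) =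
      expvec (\<lambda>v. k j * lookup (\<gamma> j) v) + expvec (\<lambda>v. \<Sum>i\<in>C. k i * lookup (\<gamma> i) v)"
    using insert by (intro poly_mapping_eqI) (simp add: lookup_add)
  then show ?case
    using insert upow_add[OF upow_scale[of "\<gamma> j" U "k j"]] by simp
qed simp

section \<open>Minimal generators\<close>

lemma mingens_mideal:
  "mingens (mideal U :: ('n, 'k::field) mpoly set) = {a \<in> U. \<forall>b\<in>U. mdvd b a \<longrightarrow> b = a}"
  by (auto simp: mingens_def)

lemma mdvd_imp_degree_less:
  fixes a b :: "'n::finite \<Rightarrow>\<^sub>0 nat"
  assumes "mdvd b a" "b \<noteq> a"
  shows "(\<Sum>i\<in>UNIV. lookup b i) < (\<Sum>i\<in>UNIV. lookup a i)"
proof (rule sum_strict_mono_ex1)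
  show "\<exists>i\<in>UNIV. lookup b i < lookup a i"
    using assms mdvd_antisym[of b a] unfolding mdvd_def by (meson UNIV_I not_le)
qed (use assms in \<open>auto simp: mdvd_def\<close>)

text \<open>Proper divisors have smaller total degree, so descending from any exponent of the ideal
  ends at a minimal one.\<close>

lemma upc_mingens:
  fixes U :: "('n::finite \<Rightarrow>\<^sub>0 nat) set"
  assumes "upset U"
  shows "upc (mingens (mideal U :: ('n, 'k::field) mpoly set)) = U" (is "upc ?G = U")
proof
  show "upc ?G \<subseteq> U"
    using upsetD[OF assms] by (auto simp: upc_def mingens_mideal)
  show "U \<subseteq> upc ?G"
  proof
    fix a assume "a \<in> U"
    then show "a \<in> upc ?G"
    proof (induction "\<Sum>i\<in>UNIV. lookup a i" arbitrary: a rule: less_induct)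
      case less
      show ?case
      proof (cases "a \<in> ?G")
        case True
        then show ?thesis using subset_upc by blast
      next
        case False
        then obtain b where b: "b \<in> U" "mdvd b a" "b \<noteq> a"
          using less.prems by (auto simp: mingens_mideal)
        then have "b \<in> upc ?G"
          using less.hyps mdvd_imp_degree_less by blast
        then show ?thesis using upsetD[OF upset_upc] b(2) by blast
      qed
    qed
  qed
qed

lemma monomial_ideal_eq_mideal:
  fixes I :: "('n::finite, 'k::field) mpoly set"
  assumes "monomial_ideal I"
  shows "I = mideal (upc (mingens I))"
proof -
  from assms obtain M where M: "I = mideal (upc M)"
    unfolding monomial_ideal_def ideal_gen_monom by blast
  show ?thesis
    using upc_mingens[OF upset_upc, of M, where 'k = 'k] by (simp only: M)
qed

section \<open>Saturation and prime monomial ideals\<close>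

text \<open>Substitute for leading terms: coordinate by coordinate, \<open>F\<close> and
  \<open>G\<close> shrink to the faces where that coordinate is least. Throughout, a sum of an
  element of each face has no other decomposition than within the faces; once all coordinates are
  used, the faces are single points.\<close>

lemma uniquely_attained_sum:
  fixes F G :: "('n::finite \<Rightarrow>\<^sub>0 nat) set"
  assumes "F \<noteq> {}" "G \<noteq> {}"
  obtains a b where "a \<in> F" "b \<in> G"
    "\<And>a' b'. a' \<in> F \<Longrightarrow> b' \<in> G \<Longrightarrow> a' + b' = a + b \<Longrightarrow> a' = a \<and> b' = b"
proof -
  have "\<exists>F' G'. F' \<noteq> {} \<and> G' \<noteq> {} \<and> F' \<subseteq> F \<and> G' \<subseteq> G \<and>
      (\<forall>a\<in>F'. \<forall>a'\<in>F'. \<forall>i\<in>X. lookup a i = lookup a' i) \<and>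
      (\<forall>b\<in>G'. \<forall>b'\<in>G'. \<forall>i\<in>X. lookup b i = lookup b' i) \<and>
      (\<forall>a'\<in>F. \<forall>b'\<in>G. \<forall>a\<in>F'. \<forall>b\<in>G'. a' + b' = a + b \<longrightarrow> a' \<in> F' \<and> b' \<in> G')"
    if "finite X" for X :: "'n set"
    using that
  proof induction
    case empty
    show ?case using assms by (intro exI[of _ F] exI[of _ G]) auto
  next
    case (insert x X)
    from insert.IH obtain F' G' where IH: "F' \<noteq> {}" "G' \<noteq> {}" "F' \<subseteq> F" "G' \<subseteq> G"
      "\<forall>a\<in>F'. \<forall>a'\<in>F'. \<forall>i\<in>X. lookup a i = lookup a' i"
      "\<forall>b\<in>G'. \<forall>b'\<in>G'. \<forall>i\<in>X. lookup b i = lookup b' i"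
      "\<forall>a'\<in>F. \<forall>b'\<in>G. \<forall>a\<in>F'. \<forall>b\<in>G'. a' + b' = a + b \<longrightarrow> a' \<in> F' \<and> b' \<in> G'"
      by (elim exE conjE) (erule that; assumption)
    obtain a0 where a0: "a0 \<in> F'" "\<And>a. a \<in> F' \<Longrightarrow> lookup a0 x \<le> lookup a x"
      using ex_has_least_nat[of "\<lambda>a. a \<in> F'" _ "\<lambda>a. lookup a x"] IH(1) by blast
    obtain b0 where b0: "b0 \<in> G'" "\<And>b. b \<in> G' \<Longrightarrow> lookup b0 x \<le> lookup b x"
      using ex_has_least_nat[of "\<lambda>b. b \<in> G'" _ "\<lambda>b. lookup b x"] IH(2) by blast
    define F'' where "F'' = {a \<in> F'. lookup a x = lookup a0 x}"
    define G'' where "G'' = {b \<in> G'. lookup b x = lookup b0 x}"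
    \<comment> \<open>The \<open>x\<close>-coordinates of \<open>a'\<close> and \<open>b'\<close>
      are at least the two minima and add up to the sum of the minima, so both are minimal.\<close>
    have "a' \<in> F'' \<and> b' \<in> G''"
      if "a' \<in> F" "b' \<in> G" "a \<in> F''" "b \<in> G''" "a' + b' = a + b" for a' b' a b
    proof -
      have mem: "a' \<in> F'" "b' \<in> G'"
        using IH(7) that unfolding F''_def G''_def by blast+
      have "lookup a' x + lookup b' x = lookup a x + lookup b x"
        using that(5) by (metis lookup_add)
      then show ?thesis
        using a0(2)[OF mem(1)] b0(2)[OF mem(2)] that(3,4) mem
        by (auto simp: F''_def G''_def)
    qed
    then have "\<forall>a'\<in>F. \<forall>b'\<in>G. \<forall>a\<in>F''. \<forall>b\<in>G''. a' + b' = a + b \<longrightarrow> a' \<in> F'' \<and> b' \<in> G''"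
      by (intro ballI impI)
    moreover have "F'' \<noteq> {}" "G'' \<noteq> {}" "F'' \<subseteq> F" "G'' \<subseteq> G"
      using a0(1) b0(1) IH(3,4) by (auto simp: F''_def G''_def)
    moreover have "\<forall>a\<in>F''. \<forall>a'\<in>F''. \<forall>i\<in>insert x X. lookup a i = lookup a' i"
      using IH(5) by (simp add: F''_def)
    moreover have "\<forall>b\<in>G''. \<forall>b'\<in>G''. \<forall>i\<in>insert x X. lookup b i = lookup b' i"
      using IH(6) by (simp add: G''_def)
    ultimately show ?case
      by (intro exI[of _ F''] exI[of _ G''] conjI) assumption+
  qed
  from this[OF finite[of UNIV]] obtain F' G' where FG: "F' \<noteq> {}" "G' \<noteq> {}" "F' \<subseteq> F" "G' \<subseteq> G"
      "\<forall>a\<in>F'. \<forall>a'\<in>F'. \<forall>i\<in>UNIV. lookup a i = lookup a' i"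
      "\<forall>b\<in>G'. \<forall>b'\<in>G'. \<forall>i\<in>UNIV. lookup b i = lookup b' i"
      "\<forall>a'\<in>F. \<forall>b'\<in>G. \<forall>a\<in>F'. \<forall>b\<in>G'. a' + b' = a + b \<longrightarrow> a' \<in> F' \<and> b' \<in> G'"
    by (elim exE conjE) (erule that; assumption)
  then obtain a b where ab: "a \<in> F'" "b \<in> G'" by blast
  have "a' = a \<and> b' = b" if "a' \<in> F" "b' \<in> G" "a' + b' = a + b" for a' b'
  proof -
    have "a' \<in> F'" "b' \<in> G'" using FG(7) ab that by blast+
    then have "lookup a' i = lookup a i" "lookup b' i = lookup b i" for i
      using FG(5,6) ab by blast+
    then show ?thesis by (auto intro: poly_mapping_eqI)
  qed
  then show thesis using that ab FG(3,4) by blast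
qed

lemma lookup_mult_unique:
  fixes f g :: "('n, 'k::field) mpoly"
  assumes "a \<in> keys f" "b \<in> keys g"
    and "\<And>a' b'. a' \<in> keys f \<Longrightarrow> b' \<in> keys g \<Longrightarrow> a' + b' = a + b \<Longrightarrow> a' = a \<and> b' = b"
  shows "lookup (f * g) (a + b) = lookup f a * lookup g b"
proof -
  have "lookup (f * g) (a + b) =
      (\<Sum>a'\<in>keys f. if a' = a then \<Sum>b'\<in>keys g. if b' = b then lookup f a * lookup g b else 0 else 0)"
    unfolding lookup_mult_double_sum
  proof (intro sum.cong refl)
    fix a' assume a': "a' \<in> keys f"
    have "(\<Sum>b'\<in>keys g. if a' + b' = a + b then lookup f a' * lookup g b' else 0)
        = (\<Sum>b'\<in>keys g. if a' = a \<and> b' = b then lookup f a * lookup g b else 0)"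
      using assms(3)[OF a'] by (intro sum.cong) auto
    then show "(\<Sum>b'\<in>keys g. if a' + b' = a + b then lookup f a' * lookup g b' else 0) =
        (if a' = a then \<Sum>b'\<in>keys g. if b' = b then lookup f a * lookup g b else 0 else 0)"
      by simp
  qed
  then show ?thesis using assms(1,2) by simp
qed

text \<open>The exponents of the prime ideal generated by the variables of \<open>C\<close>.\<close>

definition pset :: "'n set \<Rightarrow> ('n \<Rightarrow>\<^sub>0 nat) set" where
  "pset C = {a. keys a \<inter> C \<noteq> {}}"

lemma upset_pset: "upset (pset C)"
  by (auto simp: upset_def pset_def)

text \<open>Of the keys of \<open>f\<close> outside \<open>L\<close>, those of least degree in the variables of \<open>C\<close> can only
  be cancelled against each other when multiplied by the terms of \<open>g\<close> that are free of \<open>C\<close>.\<close>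

lemma mideal_saturated_cancel:
  fixes f g :: "('n::finite, 'k::field) mpoly"
  assumes L: "upset L" "\<And>a b. a + b \<in> L \<Longrightarrow> keys b \<inter> C = {} \<Longrightarrow> a \<in> L"
    and g: "g \<notin> mideal (pset C)" and gf: "g * f \<in> mideal L"
  shows "f \<in> mideal L"
proof (rule ccontr)
  assume f: "f \<notin> mideal L"
  define deg where "deg = (\<lambda>a :: 'n \<Rightarrow>\<^sub>0 nat. \<Sum>i\<in>C. lookup a i)"
  have deg_add: "deg (a + b) = deg a + deg b" for a b
    by (simp add: deg_def lookup_add sum.distrib)
  have deg_0: "deg b = 0 \<longleftrightarrow> keys b \<inter> C = {}" for b
    by (auto simp: deg_def in_keys_iff)
  have "\<exists>a. a \<in> keys f - L" using f by (auto simp: mideal_def)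
  then obtain c where c: "c \<in> keys f - L" "\<And>a. a \<in> keys f - L \<Longrightarrow> deg c \<le> deg a"
    using ex_has_least_nat[of "\<lambda>a. a \<in> keys f - L" _ deg] by blast
  define F where "F = {a \<in> keys f - L. deg a = deg c}"
  define G where "G = {b \<in> keys g. deg b = 0}"
  have "F \<noteq> {}" using c(1) by (auto simp: F_def)
  moreover have "G \<noteq> {}" using g by (auto simp: G_def deg_0 mideal_def pset_def)
  ultimately obtain a b where ab: "a \<in> F" "b \<in> G"
    "\<And>a' b'. a' \<in> F \<Longrightarrow> b' \<in> G \<Longrightarrow> a' + b' = a + b \<Longrightarrow> a' = a \<and> b' = b"
    using uniquely_attained_sum by metis
  have notL: "a + b \<notin> L"
    using L(2)[of a b] ab(1,2) by (auto simp: F_def G_def deg_0)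
  have "a' = a \<and> b' = b" if "a' \<in> keys f" "b' \<in> keys g" "a' + b' = a + b" for a' b'
  proof -
    have "a' \<notin> L" using that(3) notL L(1) unfolding upset_def by metis
    moreover have "deg a' + deg b' = deg c"
      using ab(1,2) arg_cong[OF that(3), of deg] by (simp add: deg_add F_def G_def)
    ultimately have "a' \<in> F" "b' \<in> G"
      using c(2)[of a'] that(1,2) by (auto simp: F_def G_def)
    then show ?thesis using ab(3) that(3) by blast
  qed
  then have "lookup (f * g) (a + b) = lookup f a * lookup g b"
    using ab(1,2) by (intro lookup_mult_unique) (auto simp: F_def G_def)
  also have "\<dots> \<noteq> 0" using ab(1,2) by (simp add: F_def G_def in_keys_iff)
  finally have "a + b \<in> keys (g * f)" by (simp add: in_keys_iff mult.commute)
  then show False using gf notL by (auto simp: mideal_def)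
qed

text \<open>The cancellation lemma with \<open>L = pset C\<close>: a monomial free of
  \<open>C\<close> cannot bring another one into \<open>pset C\<close>.\<close>

lemma prime_ideal_pset:
  "prime_ideal (mideal (pset C) :: ('n::finite, 'k::field) mpoly set)"
  unfolding prime_ideal_def
proof (intro conjI allI impI)
  fix f g :: "('n, 'k) mpoly"
  assume "f * g \<in> mideal (pset C)"
  then show "f \<in> mideal (pset C) \<or> g \<in> mideal (pset C)"
    using mideal_saturated_cancel[OF upset_pset, of C C f g] by (auto simp: pset_def)
qed (simp_all add: is_ideal_mideal upset_pset, simp add: mideal_def pset_def)

lemma prime_ideal_monomD:
  fixes P :: "('n::finite, 'k::field) mpoly set"
  assumes "prime_ideal P" "monom a \<in> P"
  shows "\<exists>i\<in>keys a. monom (single i 1) \<in> P"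
  using assms(2)
proof (induction "\<Sum>i\<in>UNIV. lookup a i" arbitrary: a rule: less_induct)
  case less
  have "a \<noteq> 0" using less.prems assms(1) by (auto simp: prime_ideal_def)
  then obtain i where i: "i \<in> keys a" by (metis all_not_in_conv keys_eq_empty)
  then have dvd: "mdvd (single i 1) a"
    by (auto simp: mdvd_def lookup_single when_def in_keys_iff)
  define b where "b = a - single i 1"
  have a: "a = single i 1 + b" using mdvd_imp_add[OF dvd] by (simp add: b_def)
  then have "monom (single i 1) * monom b \<in> P" using less.prems by (simp add: monom_mult)
  then consider "monom (single i 1) \<in> P" | "monom b \<in> P"
    using assms(1) unfolding prime_ideal_def by blast
  then show ?case
  proof cases
    case 2
    have "mdvd b a" "b \<noteq> a"
      by (auto simp: a mdvd_def lookup_add dest: arg_cong[of _ _ "\<lambda>c. lookup c i"])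
    then have "\<exists>j\<in>keys b. monom (single j 1) \<in> P"
      using less.hyps 2 mdvd_imp_degree_less by blast
    then show ?thesis using a by auto
  qed (use i in blast)
qed

section \<open>Minimal primes and symbolic powers\<close>

definition cover :: "('n \<Rightarrow>\<^sub>0 nat) set \<Rightarrow> 'n set \<Rightarrow> bool" where
  "cover M C \<longleftrightarrow> (\<forall>m\<in>M. keys m \<inter> C \<noteq> {})"

definition min_cover :: "('n \<Rightarrow>\<^sub>0 nat) set \<Rightarrow> 'n set \<Rightarrow> bool" where
  "min_cover M C \<longleftrightarrow> cover M C \<and> (\<forall>D. D \<subset> C \<longrightarrow> \<not> cover M D)"

lemma cover_iff_upc_subset: "cover M C \<longleftrightarrow> upc M \<subseteq> pset C"
proof
  assume "cover M C"
  then have "M \<subseteq> pset C" by (auto simp: cover_def pset_def)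
  then show "upc M \<subseteq> pset C" using upsetD[OF upset_pset] unfolding upc_def by blast
next
  assume "upc M \<subseteq> pset C"
  then show "cover M C" using subset_upc[of M] by (auto simp: cover_def pset_def)
qed

lemma mideal_mono_iff: "(mideal U :: ('n, 'k::field) mpoly set) \<subseteq> mideal V \<longleftrightarrow> U \<subseteq> V"
proof
  assume "(mideal U :: ('n, 'k) mpoly set) \<subseteq> mideal V"
  then show "U \<subseteq> V" using monom_in_mideal[where 'k = 'k] by blast
qed (auto simp: mideal_def)

lemma pset_mono_iff: "pset C \<subseteq> pset D \<longleftrightarrow> C \<subseteq> D"
proof
  assume sub: "pset C \<subseteq> pset D"
  show "C \<subseteq> D"
  proof
    fix i assume "i \<in> C"
    then have "single i 1 \<in> pset C" by (simp add: pset_def)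
    then have "single i 1 \<in> pset D" using sub by blast
    then show "i \<in> D" by (simp add: pset_def)
  qed
qed (auto simp: pset_def)

lemma exists_min_cover_subset:
  fixes C :: "'n::finite set"
  assumes "cover M C"
  obtains D where "min_cover M D" "D \<subseteq> C"
proof -
  obtain D where "D \<subseteq> C \<and> cover M D" "\<And>E. E \<subseteq> C \<and> cover M E \<Longrightarrow> card D \<le> card E"
    using ex_has_least_nat[of "\<lambda>D. D \<subseteq> C \<and> cover M D" C card] assms by blast
  then have "min_cover M D" "D \<subseteq> C"
    unfolding min_cover_def by (meson finite psubset_card_mono not_le psubset_imp_subset subset_trans)+
  then show thesis using that by blast
qed

text \<open>The variables lying in \<open>P\<close> form the cover: a prime containing a monomial
  contains one of its variables.\<close>

lemma prime_over_mideal_contains_pset: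
  fixes P :: "('n::finite, 'k::field) mpoly set"
  assumes "prime_ideal P" "mideal (upc M) \<subseteq> P"
  obtains C where "cover M C" "mideal (pset C) \<subseteq> P"
proof -
  define C where "C = {i. monom (single i 1) \<in> P}"
  have "keys m \<inter> C \<noteq> {}" if "m \<in> M" for m
  proof -
    have "monom m \<in> P"
      using that subset_upc[of M] assms(2) monom_in_mideal[of m "upc M"] by blast
    then show ?thesis using prime_ideal_monomD[OF assms(1)] by (auto simp: C_def)
  qed
  then have "cover M C" by (simp add: cover_def)
  moreover have "mideal (pset C) \<subseteq> P"
  proof (rule mideal_least)
    show ideal: "is_ideal P" using assms(1) by (simp add: prime_ideal_def)
    show "monom ` pset C \<subseteq> P"
    proof safe
      fix a assume "a \<in> pset C"
      then obtain i where i: "i \<in> keys a" "monom (single i 1) \<in> P" by (auto simp: pset_def C_def)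
      then have "mdvd (single i 1) a"
        by (auto simp: mdvd_def lookup_single when_def in_keys_iff)
      then have "monom a = monom (a - single i 1) * (monom (single i 1) :: ('n, 'k) mpoly)"
        using mdvd_imp_add[of "single i 1" a] by (metis monom_mult add.commute)
      then show "monom a \<in> P" using i(2) ideal unfolding is_ideal_def by metis
    qed
  qed
  ultimately show thesis using that by blast
qed

lemma MinAss_mideal:
  "MinAss (mideal (upc M) :: ('n::finite, 'k::field) mpoly set) =
    (\<lambda>C. mideal (pset C)) ` {C. min_cover M C}"
proof (intro equalityI subsetI)
  fix P :: "('n, 'k) mpoly set"
  assume P: "P \<in> MinAss (mideal (upc M))"
  then have "prime_ideal P" "mideal (upc M) \<subseteq> P" by (simp_all add: MinAss_def)
  from prime_over_mideal_contains_pset[OF this]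
  obtain C where C: "cover M C" "mideal (pset C) \<subseteq> P" .
  obtain D where D: "min_cover M D" "D \<subseteq> C"
    using exists_min_cover_subset[OF C(1)] .
  have "mideal (pset D) \<subseteq> P"
    using D(2) C(2) mideal_mono_iff[of "pset D" "pset C"] pset_mono_iff[of D C] by blast
  moreover have "mideal (upc M) \<subseteq> (mideal (pset D) :: ('n, 'k) mpoly set)"
    using D(1) by (simp add: mideal_mono_iff min_cover_def cover_iff_upc_subset)
  ultimately have "P = mideal (pset D)"
    using P prime_ideal_pset[of D] unfolding MinAss_def by blast
  then show "P \<in> (\<lambda>C. mideal (pset C)) ` {C. min_cover M C}" using D(1) by blast
next
  fix P :: "('n, 'k) mpoly set"
  assume "P \<in> (\<lambda>C. mideal (pset C)) ` {C. min_cover M C}"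
  then obtain C where C: "min_cover M C" "P = mideal (pset C)" by blast
  have "\<not> Q \<subset> P" if Q: "prime_ideal Q" "mideal (upc M) \<subseteq> Q" for Q
  proof
    assume "Q \<subset> P"
    obtain D where D: "cover M D" "mideal (pset D) \<subseteq> Q"
      using prime_over_mideal_contains_pset[OF Q] .
    have "mideal (pset D) \<subset> (mideal (pset C) :: ('n, 'k) mpoly set)"
      using D(2) \<open>Q \<subset> P\<close> C(2) by blast
    then have "D \<subset> C" by (auto simp: psubset_eq mideal_mono_iff pset_mono_iff)
    then show False using D(1) C(1) by (auto simp: min_cover_def)
  qed
  moreover have "mideal (upc M) \<subseteq> P"
    using C by (simp add: mideal_mono_iff min_cover_def cover_iff_upc_subset)
  ultimately show "P \<in> MinAss (mideal (upc M))"
    using prime_ideal_pset C(2) unfolding MinAss_def by blast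
qed

text \<open>The exponents of the contraction of the localised ideal: variables outside
  \<open>C\<close> become units, and \<open>y\<close> is a monomial denominator.\<close>

definition loc :: "'n set \<Rightarrow> ('n \<Rightarrow>\<^sub>0 nat) set \<Rightarrow> ('n \<Rightarrow>\<^sub>0 nat) set" where
  "loc C W = {a. \<exists>y. keys y \<inter> C = {} \<and> a + y \<in> W}"

text \<open>Monomial denominators suffice. An arbitrary \<open>g\<close> outside the prime is
  cancelled because \<open>loc C W\<close> is saturated with respect to monomials free of
  \<open>C\<close>; conversely the denominators of the single terms of \<open>f\<close> are
  multiplied together.\<close>

lemma contraction_mideal:
  fixes f :: "('n::finite, 'k::field) mpoly"
  assumes "upset W"
  shows "(\<exists>g. g \<notin> mideal (pset C) \<and> g * f \<in> mideal W) \<longleftrightarrow> f \<in> mideal (loc C W)"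
proof
  assume "\<exists>g. g \<notin> mideal (pset C) \<and> g * f \<in> mideal W"
  then obtain g where g: "g \<notin> mideal (pset C)" "g * f \<in> mideal W" by blast
  have "W \<subseteq> loc C W" unfolding loc_def by (auto intro!: exI[of _ 0])
  then have gf: "g * f \<in> mideal (loc C W)" using g(2) mideal_mono_iff by blast
  show "f \<in> mideal (loc C W)"
  proof (rule mideal_saturated_cancel[OF _ _ g(1) gf])
    have "a + b + y \<in> W" if "a + y \<in> W" for a b y
      using assms that unfolding upset_def by (metis add.commute add.left_commute)
    then show "upset (loc C W)" unfolding upset_def loc_def by blast
    show "a \<in> loc C W" if ab: "a + b \<in> loc C W" "keys b \<inter> C = {}" for a b
    proof -
      obtain y where "keys y \<inter> C = {}" "a + b + y \<in> W" using ab(1) by (auto simp: loc_def)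
      then show ?thesis
        using ab(2) by (auto simp: loc_def add.assoc intro!: exI[of _ "b + y"])
    qed
  qed
next
  assume f: "f \<in> mideal (loc C W)"
  then have "\<forall>a\<in>keys f. \<exists>y. keys y \<inter> C = {} \<and> a + y \<in> W"
    by (auto simp: mideal_def loc_def)
  then obtain y where y: "\<And>a. a \<in> keys f \<Longrightarrow> keys (y a) \<inter> C = {}" "\<And>a. a \<in> keys f \<Longrightarrow> a + y a \<in> W"
    by metis
  define z where "z = (\<Sum>a\<in>keys f. y a)"
  have "lookup z i = 0" if "i \<in> C" for i
    using y(1) that by (force simp: z_def lookup_sum not_in_keys_iff_lookup_eq_zero[symmetric])
  then have z: "keys z \<inter> C = {}" by (auto simp: in_keys_iff)
  have "z + a \<in> W" if a: "a \<in> keys f" for a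
  proof -
    have "z + a = (a + y a) + (\<Sum>a\<in>keys f - {a}. y a)"
      using a by (simp add: z_def sum.remove add_ac)
    then show ?thesis using y(2)[OF a] assms by (simp add: upset_def)
  qed
  then have "monom z * f \<in> mideal W" by (auto simp: mideal_def elim!: keys_multE)
  moreover have "monom z \<notin> (mideal (pset C) :: ('n, 'k) mpoly set)" using z by (simp add: pset_def)
  ultimately show "\<exists>g. g \<notin> mideal (pset C) \<and> g * f \<in> mideal W" by blast
qed

lemma symb_pow_mideal:
  "symb_pow (mideal (upc M) :: ('n::finite, 'k::field) mpoly set) s =
    mideal {a. \<forall>C. min_cover M C \<longrightarrow> a \<in> loc C (upow (upc M) s)}"
proof -
  have "symb_pow (mideal (upc M) :: ('n, 'k) mpoly set) s =
      (\<Inter>C\<in>{C. min_cover M C}. mideal (loc C (upow (upc M) s)))"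
    unfolding symb_pow_def MinAss_mideal ideal_pow_mideal
    by (simp add: contraction_mideal[OF upset_upow])
  then show ?thesis by (auto simp: mideal_def)
qed

lemma simis_mideal:
  "simis (mideal (upc M) :: ('n::finite, 'k::field) mpoly set) \<longleftrightarrow>
    (\<forall>s\<ge>1. \<forall>a. (\<forall>C. min_cover M C \<longrightarrow> a \<in> loc C (upow (upc M) s)) \<longrightarrow> a \<in> upow (upc M) s)"
proof -
  have "upow (upc M) s \<subseteq> {a. \<forall>C. min_cover M C \<longrightarrow> a \<in> loc C (upow (upc M) s)}" for s
    unfolding loc_def by (auto intro!: exI[of _ 0])
  then show ?thesis
    unfolding simis_def symb_pow_mideal ideal_pow_mideal
    by (auto simp: set_eq_subset[of "mideal _"] mideal_mono_iff)
qed

section \<open>Radicals\<close>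

lemma is_ideal_radical:
  assumes "is_ideal I"
  shows "is_ideal (radical I)"
proof -
  have mult: "r * a \<in> I" if "a \<in> I" for r a using assms that by (auto simp: is_ideal_def)
  have "f + g \<in> radical I" if "f \<in> radical I" "g \<in> radical I" for f g
  proof -
    from that obtain k l where kl: "f ^ k \<in> I" "g ^ l \<in> I" by (auto simp: radical_def)
    have "(f + g) ^ (k + l) \<in> I"
      unfolding binomial_ring
    proof (rule is_ideal_sum[OF assms])
      fix i assume "i \<in> {..k + l}"
      show "of_nat (k + l choose i) * f ^ i * g ^ (k + l - i) \<in> I"
      proof (cases "k \<le> i")
        case True
        then have "f ^ i = f ^ (i - k) * f ^ k" by (simp flip: power_add)
        then have "of_nat (k + l choose i) * f ^ i * g ^ (k + l - i) =
            (of_nat (k + l choose i) * g ^ (k + l - i) * f ^ (i - k)) * f ^ k"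
          by (simp add: mult_ac)
        then show ?thesis using mult[OF kl(1)] by simp
      next
        case False
        then have "g ^ (k + l - i) = g ^ (k - i) * g ^ l" by (simp flip: power_add)
        then have "of_nat (k + l choose i) * f ^ i * g ^ (k + l - i) =
            (of_nat (k + l choose i) * f ^ i * g ^ (k - i)) * g ^ l"
          by (simp add: mult_ac)
        then show ?thesis using mult[OF kl(2)] by simp
      qed
    qed
    then show ?thesis by (auto simp: radical_def)
  qed
  moreover have "r * f \<in> radical I" if "f \<in> radical I" for r f
    using that mult by (auto simp: radical_def power_mult_distrib)
  moreover have "0 \<in> radical I"
    using assms by (auto simp: radical_def is_ideal_def intro!: exI[of _ 1])
  ultimately show ?thesis by (simp add: is_ideal_def)
qed

lemma prime_ideal_power:
  assumes "prime_ideal P" "f ^ k \<in> P"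
  shows "f \<in> P"
  using assms(2) by (induction k) (use assms(1) in \<open>auto simp: prime_ideal_def\<close>)

text \<open>A power of a monomial lies in the ideal once its support contains that of a generator.
  The other inclusion tests \<open>f\<close> against the primes containing the ideal.\<close>

lemma radical_mideal:
  "radical (mideal (upc M) :: ('n::finite, 'k::field) mpoly set) =
    mideal {a. \<exists>m\<in>M. keys m \<subseteq> keys a}"
proof (intro equalityI subsetI)
  fix f :: "('n, 'k) mpoly"
  assume "f \<in> radical (mideal (upc M))"
  then obtain k where k: "f ^ k \<in> mideal (upc M)" by (auto simp: radical_def)
  have "\<exists>m\<in>M. keys m \<subseteq> keys a" if a: "a \<in> keys f" for a
  proof (rule ccontr)
    assume "\<not> ?thesis"
    \<comment> \<open>The prime generated by the variables not in \<open>a\<close> contains the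
      ideal, hence \<open>f\<close>, but not the term \<open>a\<close> of \<open>f\<close>.\<close>
    then have "cover M (- keys a)" by (auto simp: cover_def)
    then have "f ^ k \<in> mideal (pset (- keys a))"
      using k mideal_mono_iff cover_iff_upc_subset by blast
    then have "f \<in> mideal (pset (- keys a))" by (rule prime_ideal_power[OF prime_ideal_pset])
    then show False using a by (auto simp: mideal_def pset_def)
  qed
  then show "f \<in> mideal {a. \<exists>m\<in>M. keys m \<subseteq> keys a}" by (auto simp: mideal_def)
next
  have "mideal {a. \<exists>m\<in>M. keys m \<subseteq> keys a} \<subseteq> radical (mideal (upc M) :: ('n, 'k) mpoly set)"
  proof (rule mideal_least[OF is_ideal_radical[OF is_ideal_mideal[OF upset_upc]]], safe)
    fix a m :: "'n \<Rightarrow>\<^sub>0 nat"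
    assume m: "m \<in> M" "keys m \<subseteq> keys a"
    define k where "k = (\<Sum>i\<in>UNIV. lookup m i)"
    have "lookup m i \<le> k * lookup a i" for i
    proof (cases "i \<in> keys m")
      case True
      then have "i \<in> keys a" using m(2) by blast
      then have "lookup a i \<ge> 1" by (simp add: in_keys_iff Suc_le_eq)
      moreover have "lookup m i \<le> k" unfolding k_def by (rule member_le_sum) auto
      ultimately show ?thesis by (metis mult.right_neutral mult_le_mono)
    qed (simp add: in_keys_iff)
    then have "mdvd m (\<Sum>i<k. a)" by (simp add: mdvd_def lookup_sum)
    then have "monom a ^ k \<in> (mideal (upc M) :: ('n, 'k) mpoly set)"
      using m(1) by (auto simp: monom_power upc_def simp del: sum_constant)
    then show "monom a \<in> radical (mideal (upc M) :: ('n, 'k) mpoly set)"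
      unfolding radical_def by blast
  qed
  then show "f \<in> radical (mideal (upc M))" if "f \<in> mideal {a. \<exists>m\<in>M. keys m \<subseteq> keys a}"
    for f :: "('n, 'k) mpoly" using that by blast
qed

section \<open>Irreducible decompositions\<close>

text \<open>For positive \<open>b\<close>, the exponents of the irreducible ideal
  \<open>(x i ^ b i : i \<in> C)\<close>.\<close>

definition ppset :: "'n set \<Rightarrow> ('n \<Rightarrow> nat) \<Rightarrow> ('n \<Rightarrow>\<^sub>0 nat) set" where
  "ppset C b = {a. \<exists>i\<in>C. b i \<le> lookup a i}"

lemma ppset_eq_upc: "ppset C b = upc ((\<lambda>i. single i (b i)) ` C)"
  by (fastforce simp: ppset_def upc_def mdvd_def lookup_single when_def split: if_splits)

lemma upset_ppset: "upset (ppset C b)"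
  unfolding ppset_eq_upc by (rule upset_upc)

lemma radical_ppset:
  assumes "\<forall>i. 0 < b i"
  shows "radical (mideal (ppset C b) :: ('n::finite, 'k::field) mpoly set) = mideal (pset C)"
proof -
  have "{a. \<exists>m\<in>(\<lambda>i. single i (b i)) ` C. keys m \<subseteq> keys a} = pset C"
    using assms by (auto simp: pset_def)
  then show ?thesis unfolding ppset_eq_upc radical_mideal by simp
qed

text \<open>The socle of the quotient by a power ideal is spanned, over the variables outside \<open>C\<close>, by the
  monomial with exponents \<open>b i - 1\<close>; so every strictly larger ideal meets it.\<close>

lemma ideal_above_ppset_meets_socle:
  fixes A :: "('n::finite, 'k::field) mpoly set"
  assumes A: "is_ideal A" "mideal (ppset C b) \<subset> A"
  obtains h where "h \<notin> mideal (pset C)"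
    "monom (expvec (\<lambda>i. if i \<in> C then b i - 1 else 0)) * h \<in> A"
proof -
  let ?t = "expvec (\<lambda>i. if i \<in> C then b i - 1 else 0)"
  obtain f where f: "f \<in> A" "f \<notin> mideal (ppset C b)" using A(2) by blast
  define deg where "deg = (\<lambda>a :: 'n \<Rightarrow>\<^sub>0 nat. \<Sum>i\<in>C. lookup a i)"
  have "\<exists>a. a \<in> keys f - ppset C b" using f(2) by (auto simp: mideal_def)
  then obtain c where c: "c \<in> keys f - ppset C b" "\<And>a. a \<in> keys f - ppset C b \<Longrightarrow> deg c \<le> deg a"
    using ex_has_least_nat[of "\<lambda>a. a \<in> keys f - ppset C b" _ deg] by blast
  have cb: "lookup c i < b i" if "i \<in> C" for i
    using c(1) that by (auto simp: ppset_def not_le)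
  define K where "K = {a \<in> keys f. \<forall>i\<in>C. lookup a i = lookup c i}"
  \<comment> \<open>Multiplication by \<open>r\<close> lifts the terms that agree with
    \<open>c\<close> on \<open>C\<close> to socle exponents \<open>b i - 1\<close>. By minimality of
    \<open>c\<close>, any other term outside \<open>ppset C b\<close> exceeds \<open>c\<close> at
    some \<open>i\<close> in \<open>C\<close> and is pushed into the power ideal.\<close>
  define r where "r = expvec (\<lambda>i. if i \<in> C then b i - 1 - lookup c i else 0)"
  define out where "out = (\<lambda>a. expvec (\<lambda>i. if i \<in> C then 0 else lookup a i))"
  define h where "h = (\<Sum>a\<in>K. single (out a) (lookup f a))"
  have K: "finite K" "K \<subseteq> keys f" "c \<in> K" using c(1) by (auto simp: K_def)
  have shift: "r + a = ?t + out a" if "a \<in> K" for a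
  proof (rule poly_mapping_eqI)
    fix i
    show "lookup (r + a) i = lookup (?t + out a) i"
      using that cb[of i] by (auto simp: lookup_add r_def out_def K_def)
  qed
  have inQ: "r + a \<in> ppset C b" if a: "a \<in> keys f - K" for a
  proof (cases "a \<in> ppset C b")
    case True
    then show ?thesis using upset_add_left[OF upset_ppset] by blast
  next
    case False
    have "\<exists>i\<in>C. lookup c i < lookup a i"
    proof (rule ccontr)
      assume "\<not> ?thesis"
      then have le: "\<And>i. i \<in> C \<Longrightarrow> lookup a i \<le> lookup c i" by (auto simp: not_less)
      obtain i where "i \<in> C" "lookup a i \<noteq> lookup c i" using a by (auto simp: K_def)
      then have "\<exists>i\<in>C. lookup a i < lookup c i" using le by (auto simp: le_less)
      then have "deg a < deg c" unfolding deg_def using le by (intro sum_strict_mono_ex1) auto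
      then show False using c(2)[of a] a False by auto
    qed
    then show ?thesis by (force simp: ppset_def lookup_add r_def)
  qed
  have "monom r * f = monom r * (\<Sum>a\<in>keys f. single a (lookup f a))" by (simp add: poly_sum_single)
  also have "\<dots> = (\<Sum>a\<in>keys f. single (r + a) (lookup f a))"
    by (simp add: sum_distrib_left monom_def mult_single)
  also have "\<dots> = (\<Sum>a\<in>K. single (r + a) (lookup f a)) + (\<Sum>a\<in>keys f - K. single (r + a) (lookup f a))"
    using K by (simp add: sum.subset_diff add.commute)
  also have "(\<Sum>a\<in>K. single (r + a) (lookup f a)) = monom ?t * h"
    unfolding h_def sum_distrib_left using shift by (intro sum.cong) (auto simp: monom_def mult_single)
  finally have eq: "monom ?t * h = monom r * f - (\<Sum>a\<in>keys f - K. single (r + a) (lookup f a))"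
    by simp
  have "(\<Sum>a\<in>keys f - K. single (r + a) (lookup f a)) \<in> mideal (ppset C b)"
    using inQ by (intro is_ideal_sum[OF is_ideal_mideal[OF upset_ppset]]) (auto simp: mideal_def)
  then have "(\<Sum>a\<in>keys f - K. single (r + a) (lookup f a)) \<in> A" using A(2) by blast
  moreover have "monom r * f \<in> A" using A(1) f(1) unfolding is_ideal_def by blast
  ultimately have "monom ?t * h \<in> A" unfolding eq using is_ideal_diff[OF A(1)] by blast
  moreover have "h \<notin> mideal (pset C)"
  proof -
    have "a = c" if "a \<in> K" "out a = out c" for a
    proof (rule poly_mapping_eqI)
      fix i
      show "lookup a i = lookup c i"
        using that(1) arg_cong[OF that(2), of "\<lambda>v. lookup v i"]
        by (cases "i \<in> C") (simp_all add: K_def out_def)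
    qed
    then have "lookup h (out c) = (\<Sum>a\<in>K. if a = c then lookup f a else 0)"
      unfolding h_def lookup_sum lookup_single when_def by (intro sum.cong) auto
    also have "\<dots> = lookup f c" using K by simp
    finally have "out c \<in> keys h" using c(1) by (simp add: in_keys_iff)
    moreover have "out c \<notin> pset C" by (auto simp: pset_def out_def)
    ultimately show ?thesis by (auto simp: mideal_def)
  qed
  ultimately show thesis using that by blast
qed

text \<open>Two larger ideals, monomial or not, contain socle multiples \<open>t * h\<close> and
  \<open>t * k\<close> with \<open>h\<close>, \<open>k\<close> outside the prime of
  \<open>C\<close>. If they met in the power ideal, it would contain \<open>t * h * k\<close>; as
  \<open>t\<close> is one short of \<open>b i\<close> at each \<open>i\<close> in \<open>C\<close>,
  this forces \<open>h * k\<close> into the prime.\<close>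

lemma irreducible_ideal_ppset:
  assumes b: "\<forall>i. 0 < b i"
  shows "irreducible_ideal (mideal (ppset C b) :: ('n::finite, 'k::field) mpoly set)"
  unfolding irreducible_ideal_def
proof (intro conjI notI)
  let ?Q = "mideal (ppset C b) :: ('n, 'k) mpoly set"
  show "is_ideal ?Q" by (rule is_ideal_mideal[OF upset_ppset])
  assume "?Q = UNIV"
  then have "monom 0 \<in> ?Q" by blast
  then obtain i where "b i = 0" by (auto simp: ppset_def simp del: monom_zero)
  then show False using b by (metis less_irrefl)
next
  let ?Q = "mideal (ppset C b) :: ('n, 'k) mpoly set"
  let ?t = "expvec (\<lambda>i. if i \<in> C then b i - 1 else 0)"
  assume "\<exists>A B. is_ideal A \<and> is_ideal B \<and> ?Q \<subset> A \<and> ?Q \<subset> B \<and> ?Q = A \<inter> B"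
  then obtain A B where AB: "is_ideal A" "is_ideal B" "?Q \<subset> A" "?Q \<subset> B" "?Q = A \<inter> B" by blast
  obtain h where h: "h \<notin> mideal (pset C)" "monom ?t * h \<in> A"
    using ideal_above_ppset_meets_socle[OF AB(1,3)] .
  obtain k where k: "k \<notin> mideal (pset C)" "monom ?t * k \<in> B"
    using ideal_above_ppset_meets_socle[OF AB(2,4)] .
  have "k * (monom ?t * h) \<in> A" "h * (monom ?t * k) \<in> B"
    using h(2) k(2) AB(1,2) unfolding is_ideal_def by blast+
  then have mem: "monom ?t * (h * k) \<in> ?Q"
    unfolding AB(5) by (simp add: mult_ac)
  have "h * k \<in> mideal (pset C)"
    unfolding mideal_def
  proof (intro CollectI subsetI)
    fix c assume "c \<in> keys (h * k)"
    then have "?t + c \<in> keys (monom ?t * (h * k))" by (simp add: in_keys_iff lookup_monom_mult)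
    then have "?t + c \<in> ppset C b" using mem by (auto simp: mideal_def)
    then obtain i where i: "i \<in> C" "b i \<le> b i - 1 + lookup c i" by (auto simp: ppset_def lookup_add)
    then have "i \<in> keys c" using b by (auto simp: in_keys_iff dest: spec[of _ i])
    then show "c \<in> pset C" using i(1) by (auto simp: pset_def)
  qed
  then show False using h(1) k(1) prime_ideal_pset[of C, where 'k = 'k] unfolding prime_ideal_def by blast
qed

lemma monomial_ideal_mideal: "upset U \<Longrightarrow> monomial_ideal (mideal U :: ('n, 'k::field) mpoly set)"
  unfolding monomial_ideal_def ideal_gen_monom by (metis upc_upset)

text \<open>Each monomial outside the ideal is excluded by a power ideal containing the ideal.
  Bounding the exponents by \<open>K\<close> leaves finitely many candidates.\<close>

lemma exists_irr_decomp:
  fixes M :: "('n::finite \<Rightarrow>\<^sub>0 nat) set"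
  assumes "\<And>m i. m \<in> M \<Longrightarrow> lookup m i \<le> K" "0 < K"
  obtains \<Q> where "irr_decomp (mideal (upc M) :: ('n, 'k::field) mpoly set) \<Q>"
    "\<And>Q. Q \<in> \<Q> \<Longrightarrow> \<exists>C b. Q = mideal (ppset C b) \<and> (\<forall>i. 0 < b i \<and> b i \<le> K)"
proof -
  let ?I = "mideal (upc M) :: ('n, 'k) mpoly set"
  let ?B = "{b :: 'n \<Rightarrow> nat. \<forall>i. 0 < b i \<and> b i \<le> K}"
  define \<F> where "\<F> = {Q. ?I \<subseteq> Q \<and> Q \<in> (\<lambda>(C, b). mideal (ppset C b)) ` (UNIV \<times> ?B)}"
  have "?B \<subseteq> {b. \<forall>i. (i \<in> UNIV \<longrightarrow> b i \<in> {..K}) \<and> (i \<notin> UNIV \<longrightarrow> b i = 0)}" by auto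
  then have "finite ?B"
    by (rule finite_subset) (intro finite_set_of_finite_funs, auto)
  then have fin: "finite \<F>" unfolding \<F>_def by auto
  have "f \<in> ?I" if f: "f \<in> \<Inter>\<F>" for f
  proof -
    have "a \<in> upc M" if a: "a \<in> keys f" for a
    proof (rule ccontr)
      assume na: "a \<notin> upc M"
      \<comment> \<open>The power ideal generated just above \<open>a\<close>. Coordinates with
        \<open>lookup a i \<ge> K\<close> are left out, since no generator exceeds \<open>a\<close>
        there; the value 1 off \<open>C\<close> only keeps \<open>b\<close> positive.\<close>
      define C where "C = {i. lookup a i < K}"
      define b where "b = (\<lambda>i. if i \<in> C then Suc (lookup a i) else 1)"
      have "m \<in> ppset C b" if m: "m \<in> M" for m
      proof -
        obtain i where "lookup a i < lookup m i"
          using na m by (auto simp: upc_def mdvd_def not_le)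
        moreover from this have "i \<in> C" using assms(1)[OF m, of i] by (simp add: C_def)
        ultimately show ?thesis by (auto simp: ppset_def b_def intro!: bexI[of _ i])
      qed
      then have "upc M \<subseteq> ppset C b" using upsetD[OF upset_ppset] unfolding upc_def by blast
      moreover have "b \<in> ?B" using assms(2) by (auto simp: b_def C_def)
      ultimately have "mideal (ppset C b) \<in> \<F>"
        unfolding \<F>_def by (auto simp: mideal_mono_iff)
      then have "a \<in> ppset C b" using f a by (auto simp: mideal_def)
      then show False by (auto simp: ppset_def b_def)
    qed
    then show ?thesis by (auto simp: mideal_def)
  qed
  then have "\<Inter>\<F> = ?I" unfolding \<F>_def by blast
  \<comment> \<open>A subfamily with as few members as possible is irredundant.\<close>
  then obtain \<Q> where \<Q>: "\<Q> \<subseteq> \<F> \<and> \<Inter>\<Q> = ?I" "\<And>\<R>. \<R> \<subseteq> \<F> \<and> \<Inter>\<R> = ?I \<Longrightarrow> card \<Q> \<le> card \<R>"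
    using ex_has_least_nat[of "\<lambda>\<Q>. \<Q> \<subseteq> \<F> \<and> \<Inter>\<Q> = ?I" \<F> card] by blast
  have fin\<Q>: "finite \<Q>" using \<Q>(1) fin finite_subset by blast
  have form: "\<exists>C b. Q = mideal (ppset C b) \<and> (\<forall>i. 0 < b i \<and> b i \<le> K)" if "Q \<in> \<Q>" for Q
  proof -
    have "Q \<in> \<F>" using that \<Q>(1) by blast
    then show ?thesis unfolding \<F>_def by auto
  qed
  have "\<Inter>(\<Q> - {Q}) \<noteq> ?I" if Q: "Q \<in> \<Q>" for Q
  proof
    assume "\<Inter>(\<Q> - {Q}) = ?I"
    moreover have "\<Q> - {Q} \<subseteq> \<F>" using \<Q>(1) by blast
    ultimately have "card \<Q> \<le> card (\<Q> - {Q})" using \<Q>(2) by blast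
    then show False using card_Diff1_less[OF fin\<Q> Q] by simp
  qed
  moreover have "monomial_ideal Q \<and> irreducible_ideal Q" if "Q \<in> \<Q>" for Q
    using form[OF that] monomial_ideal_mideal[OF upset_ppset] irreducible_ideal_ppset by metis
  ultimately have "irr_decomp ?I \<Q>"
    unfolding irr_decomp_def using fin\<Q> \<Q>(1) by blast
  then show thesis using that form by blast
qed

text \<open>With \<open>a C i\<close> the least \<open>i\<close>-exponent of a generator meeting \<open>C\<close> in \<open>i\<close> only, this says that the
  localisation at each minimal prime \<open>(x i : i \<in> C)\<close> is the power ideal \<open>(x i ^ a C i : i \<in> C)\<close>.\<close>

definition locally_irreducible :: "('n \<Rightarrow>\<^sub>0 nat) set \<Rightarrow> bool" where
  "locally_irreducible M \<longleftrightarrow> (\<forall>C. min_cover M C \<longrightarrow>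
    (\<forall>g\<in>M. \<exists>i\<in>keys g. \<exists>h\<in>M. keys h \<inter> C = {i} \<and> lookup h i \<le> lookup g i))"

text \<open>By minimality only one component has the prime of \<open>C\<close> as its radical, and
  the exponent \<open>K\<close> on all variables outside \<open>C\<close> lies in every other
  component. Hence a power \<open>b i\<close> of one variable in \<open>C\<close>, times such a
  monomial, is in the ideal, and the generator \<open>h\<close> below it is the one sought.\<close>

lemma minimal_irr_decomp_imp_locally_irreducible:
  fixes M :: "('n::finite \<Rightarrow>\<^sub>0 nat) set"
  assumes "finite M"
    and min: "minimal_irr_decomp (mideal (upc M) :: ('n, 'k::field) mpoly set)"
  shows "locally_irreducible M"
  unfolding locally_irreducible_def
proof (intro allI impI ballI)
  fix C g assume C: "min_cover M C" and g: "g \<in> M"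
  let ?I = "mideal (upc M) :: ('n, 'k) mpoly set"
  define K where "K = Suc (\<Sum>m\<in>M. \<Sum>i\<in>UNIV. lookup m i)"
  have K: "lookup m i \<le> K" if "m \<in> M" for m i
  proof -
    have "lookup m i \<le> (\<Sum>i\<in>UNIV. lookup m i)" by (rule member_le_sum) auto
    also have "\<dots> \<le> (\<Sum>m\<in>M. \<Sum>i\<in>UNIV. lookup m i)"
      using that \<open>finite M\<close> by (intro member_le_sum) auto
    finally show ?thesis by (simp add: K_def)
  qed
  have "0 < K" by (simp add: K_def)
  from exists_irr_decomp[OF K this]
  obtain \<Q> where \<Q>: "irr_decomp ?I \<Q>"
    "\<And>Q. Q \<in> \<Q> \<Longrightarrow> \<exists>C b. Q = mideal (ppset C b) \<and> (\<forall>i. 0 < b i \<and> b i \<le> K)" by blast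
  have I: "?I = \<Inter>\<Q>" using \<Q>(1) by (simp add: irr_decomp_def)
  have rad: "Q = Q'" if "Q \<in> \<Q>" "Q' \<in> \<Q>" "radical Q = radical Q'" for Q Q'
    using min \<Q>(1) that unfolding minimal_irr_decomp_def by blast
  \<comment> \<open>The radical of this component is the prime of a cover
    \<open>D \<noteq> C\<close>. Since \<open>C\<close> is minimal, \<open>D\<close> has a vertex
    outside \<open>C\<close>, where the exponent \<open>K\<close> is large enough.\<close>
  have other: "a \<in> ppset D b"
    if D: "mideal (ppset D b) \<in> \<Q>" "D \<noteq> C" "\<forall>i. 0 < b i \<and> b i \<le> K"
      and a: "\<And>i. i \<notin> C \<Longrightarrow> lookup a i = K" for D b a
  proof -
    have "upc M \<subseteq> ppset D b" using D(1) I mideal_mono_iff by blast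
    also have "ppset D b \<subseteq> pset D"
    proof
      fix a assume "a \<in> ppset D b"
      then obtain i where "i \<in> D" "b i \<le> lookup a i" by (auto simp: ppset_def)
      moreover from this have "i \<in> keys a" using D(3) by (metis in_keys_iff le_zero_eq less_irrefl)
      ultimately show "a \<in> pset D" by (auto simp: pset_def)
    qed
    finally have "cover M D" by (simp add: cover_iff_upc_subset)
    then obtain v where "v \<in> D" "v \<notin> C" using C D(2) by (auto simp: min_cover_def)
    then show ?thesis using a D(3) by (auto simp: ppset_def)
  qed
  \<comment> \<open>Otherwise a monomial free of \<open>C\<close> would lie in every component,
    hence in the ideal, although \<open>C\<close> is a cover.\<close>
  have exQ: "\<exists>b. mideal (ppset C b) \<in> \<Q> \<and> (\<forall>i. 0 < b i \<and> b i \<le> K)"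
  proof (rule ccontr)
    assume none: "\<not> ?thesis"
    let ?a = "expvec (\<lambda>i. if i \<in> C then 0 else K)"
    have "monom ?a \<in> Q" if "Q \<in> \<Q>" for Q
    proof -
      obtain D b where D: "Q = mideal (ppset D b)" "\<forall>i. 0 < b i \<and> b i \<le> K"
        using \<Q>(2)[OF \<open>Q \<in> \<Q>\<close>] by blast
      then have "D \<noteq> C" using none \<open>Q \<in> \<Q>\<close> by blast
      then show ?thesis using other[of D b ?a] D \<open>Q \<in> \<Q>\<close> by auto
    qed
    then have "monom ?a \<in> ?I" unfolding I by blast
    then have "?a \<in> pset C" using C by (auto simp: min_cover_def cover_iff_upc_subset)
    then show False by (auto simp: pset_def split: if_splits)
  qed
  then obtain b where b: "mideal (ppset C b) \<in> \<Q>" "\<forall>i. 0 < b i \<and> b i \<le> K" by blast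
  have "g \<in> upc M" using g subset_upc by blast
  then have "monom g \<in> \<Inter>\<Q>" unfolding I[symmetric] by simp
  then have "monom g \<in> (mideal (ppset C b) :: ('n, 'k) mpoly set)" using b(1) by blast
  then obtain i where i: "i \<in> C" "b i \<le> lookup g i" by (auto simp: ppset_def)
  let ?a = "expvec (\<lambda>j. if j \<in> C then if j = i then b i else 0 else K)"
  have "monom ?a \<in> Q" if "Q \<in> \<Q>" for Q
  proof -
    obtain D d where D: "Q = mideal (ppset D d)" "\<forall>i. 0 < d i \<and> d i \<le> K"
      using \<Q>(2)[OF \<open>Q \<in> \<Q>\<close>] by blast
    show ?thesis
    proof (cases "D = C")
      case True
      have "radical Q = radical (mideal (ppset C b))"
        using D b(2) True by (simp add: radical_ppset)
      then have "Q = mideal (ppset C b)" using rad[OF \<open>Q \<in> \<Q>\<close> b(1)] by blast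
      then show ?thesis using i(1) by (auto simp: ppset_def)
    next
      case False
      then show ?thesis using other[of D d ?a] D \<open>Q \<in> \<Q>\<close> by auto
    qed
  qed
  then have "monom ?a \<in> ?I" unfolding I by blast
  then obtain h where h: "h \<in> M" "mdvd h ?a" by (auto simp: upc_def)
  then have le: "lookup h j \<le> (if j \<in> C then if j = i then b i else 0 else K)" for j
    by (simp add: mdvd_def)
  have "keys h \<inter> C \<subseteq> {i}" using le by (force simp: in_keys_iff split: if_splits)
  moreover have "keys h \<inter> C \<noteq> {}" using C h(1) by (auto simp: min_cover_def cover_def)
  ultimately have "keys h \<inter> C = {i}" by blast
  moreover have "lookup h i \<le> lookup g i" using le[of i] i by simp
  moreover have "i \<in> keys g" using i(2) b(2) by (auto simp: in_keys_iff dest: spec[of _ i])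
  ultimately show "\<exists>i\<in>keys g. \<exists>h\<in>M. keys h \<inter> C = {i} \<and> lookup h i \<le> lookup g i"
    using h(1) by blast
qed

section \<open>Tight generators of a Simis ideal\<close>

definition dot :: "('n::finite \<Rightarrow> real) \<Rightarrow> ('n \<Rightarrow>\<^sub>0 nat) \<Rightarrow> real" where
  "dot w a = (\<Sum>i\<in>UNIV. w i * real (lookup a i))"

lemma dot_add: "dot w (a + b) = dot w a + dot w b"
  by (simp add: dot_def lookup_add algebra_simps sum.distrib)

lemma dot_mono: "(\<And>i. 0 \<le> w i) \<Longrightarrow> mdvd a b \<Longrightarrow> dot w a \<le> dot w b"
  unfolding dot_def mdvd_def by (intro sum_mono mult_left_mono) auto

lemma dot_nonneg: "(\<And>i. 0 \<le> w i) \<Longrightarrow> 0 \<le> dot w a"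
  unfolding dot_def by (intro sum_nonneg mult_nonneg_nonneg) auto

lemma dot_pair:
  assumes "keys a = {i, j}" "i \<noteq> j"
  shows "dot w a = w i * lookup a i + w j * lookup a j"
proof -
  have "dot w a = (\<Sum>v\<in>keys a. w v * lookup a v)"
    unfolding dot_def by (intro sum.mono_neutral_right) (auto simp: in_keys_iff)
  then show ?thesis using assms by simp
qed

lemma dot_ge_one:
  assumes "\<And>i. 0 \<le> w i" "v \<in> keys a" "1 \<le> w v"
  shows "1 \<le> dot w a"
proof -
  have "1 \<le> lookup a v" using assms(2) by (simp add: in_keys_iff Suc_le_eq)
  then have "1 * 1 \<le> w v * lookup a v" using assms(3) by (intro mult_mono) auto
  also have "\<dots> \<le> dot w a"
    unfolding dot_def using assms(1) by (intro member_le_sum) auto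
  finally show ?thesis by simp
qed

text \<open>An inequality valid on the generators bounds from above the order of the powers
  containing \<open>u\<close>.\<close>

lemma dot_upow:
  assumes w: "\<And>i. 0 \<le> w i" "\<And>g. g \<in> M \<Longrightarrow> 1 \<le> dot w g"
  shows "u \<in> upow (upc M) s \<Longrightarrow> real s \<le> dot w u"
proof (induction s arbitrary: u)
  case (Suc s)
  then obtain a b where ab: "u = a + b" "a \<in> upc M" "b \<in> upow (upc M) s" by auto
  then obtain g where "g \<in> M" "mdvd g a" by (auto simp: upc_def)
  then have "1 \<le> dot w a" using w dot_mono by (metis order_trans)
  then show ?case using Suc.IH[OF ab(3)] by (simp add: ab(1) dot_add)
qed (simp add: dot_nonneg w)

text \<open>What remains of the ideal on the level of exponents; \<open>simis_M\<close> is the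
  inclusion of symbolic powers in ordinary powers.\<close>

locale simis_exponents =
  fixes M :: "('n::finite \<Rightarrow>\<^sub>0 nat) set"
  assumes finite_M: "finite M"
    and support2_M: "g \<in> M \<Longrightarrow> \<exists>i j. i \<noteq> j \<and> keys g = {i, j}"
    and antichain_M: "g \<in> M \<Longrightarrow> h \<in> M \<Longrightarrow> mdvd g h \<Longrightarrow> g = h"
    and locally_irreducible_M: "locally_irreducible M"
    and simis_M: "1 \<le> s \<Longrightarrow> (\<And>C. min_cover M C \<Longrightarrow> a \<in> loc C (upow (upc M) s))
      \<Longrightarrow> a \<in> upow (upc M) s"
begin

text \<open>Complementary slackness: a face of the Newton polyhedron, cut out by \<open>w\<close>, lies in the face of
  the symbolic polyhedron belonging to some minimal cover \<open>C\<close>. Otherwise the sum of the generators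
  \<open>H\<close> and of the unit vectors \<open>Z\<close> satisfies every inequality of the symbolic polyhedron strictly,
  and after clearing denominators by \<open>K!\<close> it would lie in a symbolic power beyond the reach of the
  ordinary one.\<close>

lemma tight_cover:
  assumes w: "\<And>i. 0 \<le> w i" "\<And>g. g \<in> M \<Longrightarrow> 1 \<le> dot w g"
    and H: "H \<subseteq> M" "\<And>h. h \<in> H \<Longrightarrow> dot w h = 1"
    and Z: "\<And>z. z \<in> Z \<Longrightarrow> w z = 0"
  obtains C where "min_cover M C" "C \<inter> Z = {}"
    "\<And>h. h \<in> H \<Longrightarrow> \<exists>i. keys h \<inter> C = {i} \<and> (\<forall>g\<in>M. keys g \<inter> C = {i} \<longrightarrow> lookup h i \<le> lookup g i)"
proof (rule ccontr)
  note concl = that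
  assume contra: "\<not> thesis"
  have fin_H: "finite H" using H(1) finite_M finite_subset by blast
  define K where "K = (\<Sum>m\<in>M. \<Sum>i\<in>UNIV. lookup m i)"
  have K: "lookup m i \<le> K" if "m \<in> M" for m i
  proof -
    have "lookup m i \<le> (\<Sum>i\<in>UNIV. lookup m i)" by (rule member_le_sum) auto
    also have "\<dots> \<le> K" unfolding K_def using that finite_M by (intro member_le_sum) auto
    finally show ?thesis .
  qed
  \<comment> \<open>The exponents \<open>a i\<close> below are positive and at most
    \<open>K\<close>, so they divide \<open>D\<close>, and \<open>k i = D div a i\<close> is the
    integral form of the coefficient \<open>1 / a i\<close>.\<close>
  define D :: nat where "D = fact K"
  define u0 where "u0 = (\<lambda>i. (\<Sum>h\<in>H. lookup h i) + (if i \<in> Z then 1 else 0))"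
  define u where "u = expvec (\<lambda>i. D * u0 i)"
  \<comment> \<open>One more than \<open>dot w u\<close>, which will turn out to be
    \<open>D * card H\<close>. Failure of every cover to be tight gains at least this 1, all
    quantities being integers.\<close>
  define s where "s = D * card H + 1"
  have "u \<in> loc C (upow (upc M) s)" if C: "min_cover M C" for C
  proof -
    have "\<exists>\<gamma>. \<gamma> \<in> M \<and> keys \<gamma> \<inter> C = {i} \<and>
        (\<forall>g. g \<in> M \<and> keys g \<inter> C = {i} \<longrightarrow> lookup \<gamma> i \<le> lookup g i)" if i: "i \<in> C" for i
    proof -
      have "\<not> cover M (C - {i})" using C i unfolding min_cover_def by blast
      then obtain g where "g \<in> M" "keys g \<inter> (C - {i}) = {}" by (auto simp: cover_def)
      moreover have "keys g \<inter> C \<noteq> {}" using C \<open>g \<in> M\<close> by (auto simp: min_cover_def cover_def)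
      ultimately have "g \<in> M \<and> keys g \<inter> C = {i}" by blast
      then show ?thesis
        using ex_has_least_nat[of "\<lambda>g. g \<in> M \<and> keys g \<inter> C = {i}" g "\<lambda>g. lookup g i"] by blast
    qed
    then obtain \<gamma> where \<gamma>: "\<And>i. i \<in> C \<Longrightarrow> \<gamma> i \<in> M" "\<And>i. i \<in> C \<Longrightarrow> keys (\<gamma> i) \<inter> C = {i}"
      "\<And>i g. i \<in> C \<Longrightarrow> g \<in> M \<Longrightarrow> keys g \<inter> C = {i} \<Longrightarrow> lookup (\<gamma> i) i \<le> lookup g i"
      by metis
    define a where "a = (\<lambda>i. lookup (\<gamma> i) i)"
    define k where "k = (\<lambda>i. D div a i)"
    have a_pos: "0 < a i" if "i \<in> C" for i
      using \<gamma>(2)[OF that] by (auto simp: a_def in_keys_iff)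
    have ka: "k i * a i = D" if "i \<in> C" for i
    proof -
      have "a i dvd D"
        unfolding D_def using a_pos[OF that] K[OF \<gamma>(1)[OF that]] by (intro dvd_fact) (auto simp: a_def)
      then show ?thesis by (simp add: k_def)
    qed
    have k_pos: "0 < k i" if "i \<in> C" for i
      using ka[OF that] by (auto simp: D_def intro: Nat.gr0I)
    define T where "T = (\<lambda>h. \<Sum>i\<in>C. k i * lookup h i)"
    \<comment> \<open>Local irreducibility supplies an \<open>i\<close> in \<open>C\<close> with
      \<open>a i \<le> lookup h i\<close>, so this single term of \<open>T h\<close> already reaches
      \<open>D\<close>. Equality leaves no other coordinate of \<open>h\<close> in \<open>C\<close>
      and forces \<open>lookup h i = a i\<close>.\<close>
    have T_tight: "D \<le> T h \<and> (T h = D \<longrightarrow> (\<exists>i. keys h \<inter> C = {i} \<and>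
        (\<forall>g\<in>M. keys g \<inter> C = {i} \<longrightarrow> lookup h i \<le> lookup g i)))" if h: "h \<in> H" for h
    proof -
      obtain i g where ig: "i \<in> keys h" "g \<in> M" "keys g \<inter> C = {i}" "lookup g i \<le> lookup h i"
        using locally_irreducible_M C h H(1) unfolding locally_irreducible_def by blast
      then have i: "i \<in> C" by blast
      have "a i \<le> lookup h i" using \<gamma>(3)[OF i ig(2,3)] ig(4) by (simp add: a_def)
      then have Dk: "D \<le> k i * lookup h i" using ka[OF i] by (metis mult_le_mono2)
      have T: "T h = k i * lookup h i + (\<Sum>j\<in>C - {i}. k j * lookup h j)"
        unfolding T_def using i by (simp add: sum.remove)
      have "keys h \<inter> C = {i} \<and> (\<forall>g\<in>M. keys g \<inter> C = {i} \<longrightarrow> lookup h i \<le> lookup g i)"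
        if "T h = D"
      proof -
        have eq: "k i * lookup h i = k i * a i" "(\<Sum>j\<in>C - {i}. k j * lookup h j) = 0"
          using T that Dk ka[OF i] by linarith+
        have "lookup h j = 0" if "j \<in> C - {i}" for j
        proof -
          have "\<forall>a\<in>C - {i}. k a * lookup h a = 0" using eq(2) by simp
          then have "k j * lookup h j = 0" using that by blast
          then show ?thesis using k_pos[of j] that by simp
        qed
        then have "keys h \<inter> C = {i}" using ig(1) i by (auto simp: in_keys_iff)
        moreover have "lookup h i = a i" using eq(1) k_pos[OF i] by simp
        ultimately show ?thesis using \<gamma>(3)[OF i] by (simp add: a_def)
      qed
      then show ?thesis using T Dk by auto
    qed
    define Y where "Y = (\<Sum>i\<in>C. k i * (if i \<in> Z then 1 else 0))"
    have sum_eq: "(\<Sum>i\<in>C. k i * u0 i) = (\<Sum>h\<in>H. T h) + Y"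
      unfolding u0_def T_def Y_def
      by (simp add: distrib_left sum.distrib sum_distrib_left sum.swap[of _ C H])
    have "s \<le> (\<Sum>i\<in>C. k i * u0 i)"
    proof (cases "C \<inter> Z = {}")
      case False
      then obtain z where z: "z \<in> C" "z \<in> Z" by blast
      have "k z * (if z \<in> Z then 1 else 0) \<le> Y" unfolding Y_def using z by (intro member_le_sum) auto
      then have "1 \<le> Y" using k_pos[OF z(1)] z(2) by simp
      moreover have "(\<Sum>h\<in>H. D) \<le> (\<Sum>h\<in>H. T h)" using T_tight by (intro sum_mono) blast
      ultimately show ?thesis unfolding sum_eq by (simp add: s_def mult.commute)
    next
      case True
      then have "\<exists>h\<in>H. T h \<noteq> D" using contra concl[OF C True] T_tight by blast
      then have "\<exists>h\<in>H. D < T h" using T_tight by (metis le_neq_implies_less)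
      then have "(\<Sum>h\<in>H. D) < (\<Sum>h\<in>H. T h)"
        using T_tight fin_H by (intro sum_strict_mono_ex1) auto
      then show ?thesis unfolding sum_eq by (simp add: s_def mult.commute)
    qed
    \<comment> \<open>The product of the generators \<open>\<gamma> i\<close>, each with
      multiplicity \<open>k i * u0 i\<close>. On \<open>C\<close> it agrees with \<open>u\<close>,
      as \<open>k i * a i = D\<close>; what it has outside \<open>C\<close> is absorbed by the
      denominator.\<close>
    moreover have "expvec (\<lambda>v. \<Sum>i\<in>C. k i * u0 i * lookup (\<gamma> i) v)
        \<in> upow (upc M) (\<Sum>i\<in>C. k i * u0 i)" (is "?S \<in> _")
      using \<gamma>(1) subset_upc[of M] by (intro upow_sum) auto
    ultimately have "?S \<in> upow (upc M) s" using upow_antimono by blast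
    moreover have "mdvd ?S (u + expvec (\<lambda>v. if v \<in> C then 0 else lookup ?S v))"
      unfolding mdvd_def
    proof
      fix v
      show "lookup ?S v \<le> lookup (u + expvec (\<lambda>v. if v \<in> C then 0 else lookup ?S v)) v"
      proof (cases "v \<in> C")
        case True
        have "lookup (\<gamma> i) v = 0" if "i \<in> C - {v}" for i
          using \<gamma>(2)[of i] that True by (auto simp: in_keys_iff)
        then have "lookup ?S v = k v * u0 v * lookup (\<gamma> v) v"
          using True by (simp add: sum.remove[of C v])
        also have "\<dots> = (k v * a v) * u0 v" by (simp add: a_def)
        finally show ?thesis using True by (simp add: ka lookup_add u_def)
      qed (simp add: lookup_add)
    qed
    ultimately have "u + expvec (\<lambda>v. if v \<in> C then 0 else lookup ?S v) \<in> upow (upc M) s"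
      using upsetD[OF upset_upow] by blast
    then show ?thesis
      unfolding loc_def
      by (intro CollectI exI[of _ "expvec (\<lambda>v. if v \<in> C then 0 else lookup ?S v)"]) auto
  qed
  then have "u \<in> upow (upc M) s" using simis_M[of s u] by (simp add: s_def)
  then have "real s \<le> dot w u" using dot_upow w by blast
  also have "dot w u = real D * (\<Sum>i\<in>UNIV. w i * u0 i)"
    by (simp add: dot_def u_def sum_distrib_left mult_ac)
  also have "(\<Sum>i\<in>UNIV. w i * u0 i) = (\<Sum>i\<in>UNIV. w i * (\<Sum>h\<in>H. real (lookup h i)))"
    using Z by (intro sum.cong) (auto simp: u0_def)
  also have "\<dots> = (\<Sum>h\<in>H. dot w h)"
    unfolding dot_def sum_distrib_left by (rule sum.swap)
  also have "\<dots> = card H" using H(2) by simp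
  finally show False by (simp add: s_def)
qed

text \<open>The generators on one edge are an antichain in the plane. If there are two, an edge of
  their lower convex hull gives a weight tight at both of its ends \<open>g0\<close> and
  \<open>f0\<close>. The resulting cover meets their common support in one vertex, where both have
  the same exponent; in an antichain this is impossible.\<close>

lemma generator_unique:
  assumes g: "g \<in> M" "h \<in> M" "keys g = keys h"
  shows "g = h"
proof (rule ccontr)
  assume "g \<noteq> h"
  obtain i j where ij: "i \<noteq> j" "keys g = {i, j}" using support2_M[OF g(1)] by blast
  define S where "S = {f \<in> M. keys f = {i, j}}"
  have S: "finite S" "g \<in> S" "h \<in> S" using g ij finite_M by (auto simp: S_def)
  obtain g0 where g0: "g0 \<in> S" "\<And>f. f \<in> S \<Longrightarrow> lookup g0 i \<le> lookup f i"
    using ex_has_least_nat[of "\<lambda>f. f \<in> S" g "\<lambda>f. lookup f i"] S(2) by blast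
  have mdvd_S: "mdvd f f'"
    if "f \<in> S" "f' \<in> S" "lookup f i \<le> lookup f' i" "lookup f j \<le> lookup f' j" for f f'
    unfolding mdvd_def
  proof
    fix v
    show "lookup f v \<le> lookup f' v"
    proof (cases "v \<in> {i, j}")
      case False
      then have "v \<notin> keys f" using that(1) by (simp add: S_def)
      then show ?thesis by (simp add: in_keys_iff)
    qed (use that in auto)
  qed
  have less: "lookup g0 i < lookup f i \<and> lookup f j < lookup g0 j" if f: "f \<in> S" "f \<noteq> g0" for f
  proof -
    have "\<not> mdvd g0 f" "\<not> mdvd f g0"
      using antichain_M f g0(1) unfolding S_def by blast+
    then show ?thesis
      using mdvd_S[OF g0(1) f(1)] mdvd_S[OF f(1) g0(1)] g0(2)[OF f(1)] by linarith
  qed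
  \<comment> \<open>The steepest descent from \<open>g0\<close>, the point with least
    \<open>i\<close>-exponent, leads along the lower hull; its end is \<open>f0\<close>.\<close>
  define slope where "slope = (\<lambda>f. (real (lookup g0 j) - lookup f j) / (real (lookup f i) - lookup g0 i))"
  have "S - {g0} \<noteq> {}" using S(2,3) \<open>g \<noteq> h\<close> by blast
  then obtain f0 where f0: "f0 \<in> S - {g0}" "\<And>f. f \<in> S - {g0} \<Longrightarrow> slope f \<le> slope f0"
    using S(1) ex_is_arg_min_if_finite[of "S - {g0}" "\<lambda>f. - slope f"]
    by (auto simp: is_arg_min_def not_less)
  define p where "p = real (lookup g0 j) - lookup f0 j"
  define q where "q = real (lookup f0 i) - lookup g0 i"
  have pq: "0 < p" "0 < q" using less[of f0] f0(1) by (auto simp: p_def q_def)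
  define N where "N = p * lookup g0 i + q * lookup g0 j"
  have N_f0: "N = p * lookup f0 i + q * lookup f0 j"
    by (simp add: N_def p_def q_def algebra_simps)
  have "i \<in> keys g0" using g0(1) by (simp add: S_def)
  then have "0 < p * lookup g0 i" using pq by (simp add: in_keys_iff)
  moreover have "0 \<le> q * lookup g0 j" using pq by simp
  ultimately have N: "0 < N" unfolding N_def by linarith
  \<comment> \<open>The line through \<open>g0\<close> and \<open>f0\<close>, normalised to value 1.
    A generator on another edge has a vertex outside \<open>{i, j}\<close>, where the weight is
    1.\<close>
  define w where "w = (\<lambda>v. if v = i then p / N else if v = j then q / N else 1)"
  have w_nonneg: "0 \<le> w v" for v using pq N by (simp add: w_def)
  have dot_S: "dot w f = (p * lookup f i + q * lookup f j) / N" if "f \<in> S" for f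
    using dot_pair[of f i j w] that ij(1) by (simp add: S_def w_def add_divide_distrib)
  have "1 \<le> dot w f" if f: "f \<in> M" for f
  proof (cases "f \<in> S")
    case True
    have "N \<le> p * lookup f i + q * lookup f j"
    proof (cases "f = g0")
      case False
      have "slope f \<le> p / q" using f0(2)[of f] False True by (simp add: slope_def p_def q_def)
      then have "(real (lookup g0 j) - lookup f j) * q \<le> p * (real (lookup f i) - lookup g0 i)"
        using less[OF True False] pq by (simp add: slope_def divide_le_eq le_divide_eq mult.commute)
      then show ?thesis by (simp add: N_def algebra_simps)
    qed (simp add: N_def)
    then show ?thesis using N by (simp add: dot_S[OF True])
  next
    case False
    obtain x y where xy: "x \<noteq> y" "keys f = {x, y}" using support2_M[OF f] by blast
    then have "{x, y} \<noteq> {i, j}" using False f by (simp add: S_def)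
    then obtain v where "v \<in> keys f" "v \<noteq> i" "v \<noteq> j" using xy by auto
    then show ?thesis using dot_ge_one[of w v f] w_nonneg by (simp add: w_def)
  qed
  moreover have "dot w f = 1" if "f \<in> {g0, f0}" for f
    using that dot_S[OF g0(1)] dot_S[of f0] f0(1) N N_f0 N_def by auto
  moreover have "{g0, f0} \<subseteq> M" using g0(1) f0(1) by (auto simp: S_def)
  ultimately obtain C where C: "\<And>f. f \<in> {g0, f0} \<Longrightarrow> \<exists>x. keys f \<inter> C = {x} \<and>
      (\<forall>e\<in>M. keys e \<inter> C = {x} \<longrightarrow> lookup f x \<le> lookup e x)"
    using tight_cover[where w = w and H = "{g0, f0}" and Z = "{}", OF w_nonneg] by (metis empty_iff)
  have ks: "keys g0 = {i, j}" "keys f0 = {i, j}" "g0 \<in> M" "f0 \<in> M"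
    using g0(1) f0(1) by (auto simp: S_def)
  obtain x where x: "{i, j} \<inter> C = {x}" "\<And>e. e \<in> M \<Longrightarrow> keys e \<inter> C = {x} \<Longrightarrow> lookup g0 x \<le> lookup e x"
    using C[of g0] ks by auto
  obtain x' where x': "{i, j} \<inter> C = {x'}" "\<And>e. e \<in> M \<Longrightarrow> keys e \<inter> C = {x'} \<Longrightarrow> lookup f0 x' \<le> lookup e x'"
    using C[of f0] ks by auto
  have "x' = x" using x(1) x'(1) by blast
  then have "lookup g0 x = lookup f0 x"
    using x x' ks by (metis antisym)
  moreover have "x = i \<or> x = j" using x(1) by blast
  ultimately show False using less[of f0] f0(1) by auto
qed

text \<open>Leaves only the sides of the triangle to be checked: a generator on no side reaches a
  vertex of weight 1.\<close>

lemma dot_ge_one_triangle: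
  assumes w: "\<And>v. 0 \<le> w v" "\<And>v. v \<notin> {i, j, k} \<Longrightarrow> w v = 1"
    and f: "f \<in> M" "keys f \<notin> {{i, j}, {j, k}, {i, k}}"
  shows "1 \<le> dot w f"
proof -
  obtain x y where xy: "x \<noteq> y" "keys f = {x, y}" using support2_M[OF f(1)] by blast
  have "\<not> keys f \<subseteq> {i, j, k}" using xy f(2) by (auto simp: insert_commute)
  then obtain v where "v \<in> keys f" "v \<notin> {i, j, k}" by blast
  then show ?thesis using dot_ge_one[of w v f] w by simp
qed

text \<open>This is nonnegativity of a numerator in Cramer's rule for the weight making all three
  sides tight. If it fails, a weight vanishing at \<open>i\<close> is tight on the other two edges.
  A cover without \<open>i\<close> must contain \<open>k\<close> and, because of \<open>e1\<close>,
  also \<open>j\<close>: two ends of the tight \<open>e2\<close>.\<close>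

lemma triangle_condition:
  assumes ijk: "i \<noteq> j" "j \<noteq> k" "i \<noteq> k"
    and e: "e1 \<in> M" "keys e1 = {i, j}" "e2 \<in> M" "keys e2 = {j, k}" "e3 \<in> M" "keys e3 = {i, k}"
  shows "real (lookup e1 j) * lookup e3 k \<le> real (lookup e2 j) * lookup e3 k + real (lookup e1 j) * lookup e2 k"
proof (rule ccontr)
  define q where "q = real (lookup e1 j)"
  define r where "r = real (lookup e2 j)"
  define s where "s = real (lookup e2 k)"
  define t where "t = real (lookup e3 k)"
  have "j \<in> keys e1" "j \<in> keys e2" "k \<in> keys e2" "k \<in> keys e3" using e by auto
  then have pos: "0 < q" "0 < r" "0 < s" "0 < t"
    by (auto simp: in_keys_iff q_def r_def s_def t_def)
  assume "\<not> ?thesis"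
  then have neg: "r * t + q * s < q * t" by (simp add: q_def r_def s_def t_def)
  then have "q * s < q * t" using pos mult_pos_pos[of r t] by linarith
  then have st: "s < t" using pos by simp
  \<comment> \<open>With value 0 at \<open>i\<close>, tightness of \<open>e3\<close> determines the
    value at \<open>k\<close>, then tightness of \<open>e2\<close> the value at \<open>j\<close>.
    The failed inequality is what gives \<open>dot w e1 \<ge> 1\<close>.\<close>
  define w where "w = (\<lambda>v. if v = i then 0 else if v = j then (1 - s / t) / r
      else if v = k then 1 / t else 1)"
  have w_nonneg: "0 \<le> w v" for v using pos st by (simp add: w_def)
  have d2: "dot w e2 = 1"
    using dot_pair[OF e(4) ijk(2), of w] ijk pos by (simp add: w_def flip: r_def s_def)
  have d3: "dot w e3 = 1"
    using dot_pair[OF e(6) ijk(3), of w] ijk pos by (simp add: w_def flip: t_def)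
  have "dot w e1 = q * (t - s) / (t * r)"
    using dot_pair[OF e(2) ijk(1), of w] ijk pos by (simp add: w_def field_simps flip: q_def)
  moreover have "t * r \<le> q * (t - s)" using neg by (simp add: algebra_simps)
  ultimately have d1: "1 \<le> dot w e1" using pos by simp
  have "1 \<le> dot w f" if f: "f \<in> M" for f
  proof (cases "keys f \<in> {{i, j}, {j, k}, {i, k}}")
    case True
    then have "f \<in> {e1, e2, e3}" using generator_unique[OF f] e by auto
    then show ?thesis using d1 d2 d3 by auto
  next
    case False
    then show ?thesis
      by (intro dot_ge_one_triangle[where w = w and i = i and j = j and k = k] w_nonneg f)
        (simp_all add: w_def)
  qed
  moreover have "w z = 0" if "z \<in> {i}" for z using that by (simp add: w_def)
  moreover have "dot w f = 1" if "f \<in> {e2, e3}" for f using that d2 d3 by auto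
  moreover have "{e2, e3} \<subseteq> M" using e by auto
  ultimately obtain C where C: "min_cover M C" "C \<inter> {i} = {}"
    "\<And>f. f \<in> {e2, e3} \<Longrightarrow> \<exists>x. keys f \<inter> C = {x} \<and>
      (\<forall>e\<in>M. keys e \<inter> C = {x} \<longrightarrow> lookup f x \<le> lookup e x)"
    using tight_cover[where w = w and H = "{e2, e3}" and Z = "{i}", OF w_nonneg] by metis
  obtain x where x: "{j, k} \<inter> C = {x}" using C(3)[of e2] e by auto
  obtain y where y: "{i, k} \<inter> C = {y}" using C(3)[of e3] e by auto
  have "{i, j} \<inter> C \<noteq> {}" using C(1) e(1,2) by (auto simp: min_cover_def cover_def)
  then show False using x y C(2) ijk by (cases "j \<in> C"; cases "k \<in> C") auto
qed

text \<open>If all three sides are tight at once, a set would contain exactly one end of each edge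
  of an odd cycle.\<close>

lemma no_triangle:
  assumes ijk: "i \<noteq> j" "j \<noteq> k" "i \<noteq> k"
    and e: "e1 \<in> M" "keys e1 = {i, j}" "e2 \<in> M" "keys e2 = {j, k}" "e3 \<in> M" "keys e3 = {i, k}"
  shows False
proof -
  define p where "p = real (lookup e1 i)"
  define q where "q = real (lookup e1 j)"
  define r where "r = real (lookup e2 j)"
  define s where "s = real (lookup e2 k)"
  define t where "t = real (lookup e3 k)"
  define v where "v = real (lookup e3 i)"
  note defs = p_def q_def r_def s_def t_def v_def
  have "i \<in> keys e1" "j \<in> keys e1" "j \<in> keys e2" "k \<in> keys e2" "k \<in> keys e3" "i \<in> keys e3"
    using e by auto
  then have pos: "0 < p" "0 < q" "0 < r" "0 < s" "0 < t" "0 < v"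
    by (auto simp: in_keys_iff defs)
  define \<Delta> where "\<Delta> = p * r * t + q * s * v"
  have \<Delta>: "0 < \<Delta>" using pos by (simp add: \<Delta>_def add_pos_pos)
  have ks: "keys e1 = {j, i}" "keys e2 = {k, j}" "keys e3 = {k, i}" using e by auto
  have x: "0 \<le> r * t - q * t + q * s"
    using triangle_condition[OF ijk e] by (simp add: defs algebra_simps)
  have y: "0 \<le> p * t - p * s + s * v"
    using triangle_condition[OF ijk(2) ijk(3)[symmetric] ijk(1)[symmetric] e(3,4,5) ks(3) e(1) ks(1)]
    by (simp add: defs algebra_simps)
  have z: "0 \<le> p * r + q * v - r * v"
    using triangle_condition[OF ijk(3)[symmetric] ijk(1) ijk(2)[symmetric] e(5) ks(3) e(1,2,3) ks(2)]
    by (simp add: defs algebra_simps)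
  text \<open>On the triangle, \<open>w\<close> is the solution, by Cramer's rule, of the system making all three
    generators tight.\<close>
  define w where "w = (\<lambda>u. if u = i then (r * t - q * t + q * s) / \<Delta>
      else if u = j then (p * t - p * s + s * v) / \<Delta>
      else if u = k then (p * r + q * v - r * v) / \<Delta> else 1)"
  have w_nonneg: "0 \<le> w u" for u using x y z \<Delta> by (simp add: w_def)
  have d1: "dot w e1 = 1"
  proof -
    have "dot w e1 = ((r * t - q * t + q * s) * p + (p * t - p * s + s * v) * q) / \<Delta>"
      using dot_pair[OF e(2) ijk(1), of w] ijk unfolding add_divide_distrib[of "_ * _" "_ * _"]
      by (simp add: w_def flip: p_def q_def)
    also have "(r * t - q * t + q * s) * p + (p * t - p * s + s * v) * q = \<Delta>"
      by (simp add: \<Delta>_def algebra_simps)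
    finally show ?thesis using \<Delta> by simp
  qed
  have d2: "dot w e2 = 1"
  proof -
    have "dot w e2 = ((p * t - p * s + s * v) * r + (p * r + q * v - r * v) * s) / \<Delta>"
      using dot_pair[OF e(4) ijk(2), of w] ijk unfolding add_divide_distrib[of "_ * _" "_ * _"]
      by (simp add: w_def flip: r_def s_def)
    also have "(p * t - p * s + s * v) * r + (p * r + q * v - r * v) * s = \<Delta>"
      by (simp add: \<Delta>_def algebra_simps)
    finally show ?thesis using \<Delta> by simp
  qed
  have d3: "dot w e3 = 1"
  proof -
    have "dot w e3 = ((r * t - q * t + q * s) * v + (p * r + q * v - r * v) * t) / \<Delta>"
      using dot_pair[OF e(6) ijk(3), of w] ijk unfolding add_divide_distrib[of "_ * _" "_ * _"]
      by (simp add: w_def flip: t_def v_def)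
    also have "(r * t - q * t + q * s) * v + (p * r + q * v - r * v) * t = \<Delta>"
      by (simp add: \<Delta>_def algebra_simps)
    finally show ?thesis using \<Delta> by simp
  qed
  have "1 \<le> dot w f" if f: "f \<in> M" for f
  proof (cases "keys f \<in> {{i, j}, {j, k}, {i, k}}")
    case True
    then have "f \<in> {e1, e2, e3}" using generator_unique[OF f] e by auto
    then show ?thesis using d1 d2 d3 by auto
  next
    case False
    then show ?thesis
      by (intro dot_ge_one_triangle[where w = w and i = i and j = j and k = k] w_nonneg f)
        (simp_all add: w_def)
  qed
  moreover have "dot w f = 1" if "f \<in> {e1, e2, e3}" for f using that d1 d2 d3 by auto
  moreover have "{e1, e2, e3} \<subseteq> M" using e by auto
  ultimately obtain C where C: "\<And>f. f \<in> {e1, e2, e3} \<Longrightarrow> \<exists>x. keys f \<inter> C = {x} \<and>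
      (\<forall>e\<in>M. keys e \<inter> C = {x} \<longrightarrow> lookup f x \<le> lookup e x)"
    using tight_cover[where w = w and H = "{e1, e2, e3}" and Z = "{}", OF w_nonneg] by (metis empty_iff)
  obtain x1 where x1: "{i, j} \<inter> C = {x1}" using C[of e1] e by auto
  obtain x2 where x2: "{j, k} \<inter> C = {x2}" using C[of e2] e by auto
  obtain x3 where x3: "{i, k} \<inter> C = {x3}" using C[of e3] e by auto
  from x1 x2 x3 ijk show False by (cases "i \<in> C"; cases "j \<in> C"; cases "k \<in> C") auto
qed

text \<open>With the roles of \<open>g\<close> and \<open>h\<close> exchanged it yields equality. If
  \<open>h\<close> had the larger exponent at \<open>i\<close>, a weight vanishing at the other end
  of \<open>h\<close> could be tight at both. The cover then avoids \<open>k\<close>, so it meets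
  both generators in \<open>i\<close> only, and tightness of \<open>h\<close> says that its exponent
  there is least.\<close>

lemma exponent_le:
  assumes g: "g \<in> M" "i \<in> keys g" and h: "h \<in> M" "i \<in> keys h"
  shows "lookup h i \<le> lookup g i"
proof (rule ccontr)
  assume less: "\<not> ?thesis"
  have other_end: "\<exists>j. j \<noteq> i \<and> keys f = {i, j}" if f: "f \<in> M" "i \<in> keys f" for f
  proof -
    obtain x y where "x \<noteq> y" "keys f = {x, y}" using support2_M[OF f(1)] by blast
    then show ?thesis using f(2) by (cases "i = x") (auto simp: insert_commute)
  qed
  obtain j where j: "j \<noteq> i" "keys g = {i, j}" using other_end[OF g] by blast
  obtain k where k: "k \<noteq> i" "keys h = {i, k}" using other_end[OF h] by blast
  have jk: "j \<noteq> k" using generator_unique[OF g(1) h(1)] less j(2) k(2) by auto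
  define a where "a = real (lookup g i)"
  define b where "b = real (lookup g j)"
  define c where "c = real (lookup h i)"
  have "j \<in> keys g" using j(2) by simp
  then have pos: "0 < a" "0 < b" "a < c"
    using less g(2) by (auto simp: in_keys_iff a_def b_def c_def)
  \<comment> \<open>Tightness of \<open>h\<close> with value 0 at \<open>k\<close> gives
    \<open>1 / c\<close> at \<open>i\<close>; the part of \<open>g\<close> still missing is put on
    \<open>j\<close>, and is positive because \<open>a < c\<close>.\<close>
  define w where "w = (\<lambda>v. if v = i then 1 / c else if v = j then (1 - a / c) / b
      else if v = k then 0 else 1)"
  have w_nonneg: "0 \<le> w v" for v using pos by (simp add: w_def)
  have dg: "dot w g = 1"
    using dot_pair[OF j(2) j(1)[symmetric], of w] j(1) pos by (simp add: w_def flip: a_def b_def)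
  have dh: "dot w h = 1"
    using dot_pair[OF k(2) k(1)[symmetric], of w] k(1) jk pos by (simp add: w_def flip: c_def)
  have "1 \<le> dot w f" if f: "f \<in> M" for f
  proof (cases "keys f \<in> {{i, j}, {j, k}, {i, k}}")
    case True
    \<comment> \<open>Here triangles have to be excluded first: the weight of an edge
      \<open>{j, k}\<close> could be less than 1.\<close>
    have "keys f \<noteq> {j, k}"
      using no_triangle[OF j(1)[symmetric] jk k(1)[symmetric] g(1) j(2) f _ h(1) k(2)] by blast
    then have "f \<in> {g, h}"
      using True generator_unique[OF f g(1)] generator_unique[OF f h(1)] j(2) k(2) by auto
    then show ?thesis using dg dh by auto
  next
    case False
    then show ?thesis
      by (intro dot_ge_one_triangle[where w = w and i = i and j = j and k = k] w_nonneg f)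
        (simp_all add: w_def)
  qed
  moreover have "w z = 0" if "z \<in> {k}" for z using that k(1) jk by (simp add: w_def)
  moreover have "dot w f = 1" if "f \<in> {g, h}" for f using that dg dh by auto
  moreover have "{g, h} \<subseteq> M" using g h by auto
  ultimately obtain C where C: "C \<inter> {k} = {}"
    "\<And>f. f \<in> {g, h} \<Longrightarrow> \<exists>x. keys f \<inter> C = {x} \<and>
      (\<forall>e\<in>M. keys e \<inter> C = {x} \<longrightarrow> lookup f x \<le> lookup e x)"
    using tight_cover[where w = w and H = "{g, h}" and Z = "{k}", OF w_nonneg] by metis
  obtain x where x: "{i, j} \<inter> C = {x}" using C(2)[of g] j(2) by auto
  obtain y where y: "{i, k} \<inter> C = {y}"
    "\<And>e. e \<in> M \<Longrightarrow> keys e \<inter> C = {y} \<Longrightarrow> lookup h y \<le> lookup e y"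
    using C(2)[of h] k(2) by auto
  have "y = i"
  proof -
    have "y \<in> {i, k} \<inter> C" unfolding y(1) by simp
    then show ?thesis using C(1) by blast
  qed
  moreover have "x = i"
  proof -
    have "i \<in> {i, k} \<inter> C" unfolding y(1) using \<open>y = i\<close> by simp
    then have "i \<in> {i, j} \<inter> C" by simp
    then show ?thesis unfolding x by simp
  qed
  ultimately have "lookup h i \<le> lookup g i" using x y(2)[OF g(1)] j(2) by simp
  then show False using less by simp
qed

lemma weighting_and_bipartite:
  obtains d where "\<And>i. 0 < d i" "\<And>g i. g \<in> M \<Longrightarrow> i \<in> keys g \<Longrightarrow> lookup g i = d i"
    "bipartite (keys ` M)"
proof -
  \<comment> \<open>Vertices on no edge get the value 1, to keep the weighting positive.\<close>
  define d where "d = (\<lambda>i. if \<exists>g\<in>M. i \<in> keys g then lookup (SOME g. g \<in> M \<and> i \<in> keys g) i else 1)"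
  have d: "lookup g i = d i" if "g \<in> M" "i \<in> keys g" for g i
  proof -
    have "(SOME g. g \<in> M \<and> i \<in> keys g) \<in> M \<and> i \<in> keys (SOME g. g \<in> M \<and> i \<in> keys g)"
      using that by (intro someI[of "\<lambda>g. g \<in> M \<and> i \<in> keys g" g]) blast
    then have "lookup g i = lookup (SOME g. g \<in> M \<and> i \<in> keys g) i"
      using that by (intro antisym exponent_le) simp_all
    then show ?thesis using that by (auto simp: d_def)
  qed
  have d_pos: "0 < d i" for i
  proof (cases "\<exists>g\<in>M. i \<in> keys g")
    case True
    then show ?thesis using d by (metis in_keys_iff not_gr_zero)
  qed (simp add: d_def)
  define w where "w = (\<lambda>i. 1 / (2 * real (d i)))"
  have w_nonneg: "0 \<le> w i" for i by (simp add: w_def)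
  have dot_w: "dot w g = 1" if g: "g \<in> M" for g
  proof -
    obtain i j where ij: "i \<noteq> j" "keys g = {i, j}" using support2_M[OF g] by blast
    have "lookup g i = d i" "lookup g j = d j" using d[OF g] ij(2) by auto
    then show ?thesis using dot_pair[OF ij(2,1), of w] d_pos[of i] d_pos[of j] by (simp add: w_def)
  qed
  \<comment> \<open>Every generator is tight, so \<open>C\<close> contains exactly one end of each
    edge and is one side of the bipartition.\<close>
  obtain C where C: "\<And>g. g \<in> M \<Longrightarrow> \<exists>x. keys g \<inter> C = {x} \<and>
      (\<forall>e\<in>M. keys e \<inter> C = {x} \<longrightarrow> lookup g x \<le> lookup e x)"
    using tight_cover[where w = w and H = M and Z = "{}", OF w_nonneg] dot_w by (metis empty_iff order_refl)
  have "\<exists>u v. keys g = {u, v} \<and> u \<in> C \<and> v \<notin> C" if g: "g \<in> M" for g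
  proof -
    obtain i j where ij: "i \<noteq> j" "keys g = {i, j}" using support2_M[OF g] by blast
    obtain x where "{i, j} \<inter> C = {x}" using C[OF g] ij(2) by auto
    then have "i \<in> C \<and> j \<notin> C \<or> j \<in> C \<and> i \<notin> C"
      using ij(1) by (cases "i \<in> C"; cases "j \<in> C") auto
    then show ?thesis using ij(2) by (auto simp: insert_commute)
  qed
  then have "bipartite (keys ` M)" unfolding bipartite_def by blast
  then show thesis using that d d_pos by blast
qed

end

section \<open>Weighted bipartite graphs\<close>

text \<open>The lattice operation on covers of a bipartite graph. Exchanging \<open>A\<close> with
  its complement gives the dual operation, and the two results together have the total weight of
  \<open>X\<close> and \<open>Y\<close>.\<close>

lemma cover_join:
  assumes bip: "\<And>g. g \<in> M \<Longrightarrow> \<exists>u v. keys g = {u, v} \<and> u \<in> A \<and> v \<notin> A"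
    and "cover M X" "cover M Y"
  shows "cover M ((X \<inter> Y \<inter> A) \<union> ((X \<union> Y) - A))"
  unfolding cover_def
proof
  fix g assume g: "g \<in> M"
  obtain u v where uv: "keys g = {u, v}" "u \<in> A" "v \<notin> A" using bip[OF g] by blast
  have "u \<in> X \<or> v \<in> X" "u \<in> Y \<or> v \<in> Y" using assms(2,3) g uv(1) by (auto simp: cover_def)
  then show "keys g \<inter> ((X \<inter> Y \<inter> A) \<union> ((X \<union> Y) - A)) \<noteq> {}" using uv by auto
qed

text \<open>The edge leaves a vertex \<open>j\<close> of a cover of least weight, towards a vertex outside
  the cover of least weight through \<open>j\<close> that extends furthest on the other side; so no cover of least weight
  contains both of its ends.\<close>

lemma koenig_edge_at:
  fixes c :: "'n::finite \<Rightarrow> nat"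
  assumes bip: "\<And>g. g \<in> M \<Longrightarrow> \<exists>u v. keys g = {u, v} \<and> u \<in> A \<and> v \<notin> A"
    and weight: "\<And>C. cover M C \<Longrightarrow> t \<le> sum c C"
    and X: "cover M X" "sum c X = t" "j \<in> X" "j \<in> A" "0 < c j"
  obtains g v where "g \<in> M" "keys g = {j, v}" "0 < c v"
    "\<And>C. cover M C \<Longrightarrow> sum c C = t \<Longrightarrow> j \<in> C \<Longrightarrow> v \<notin> C"
proof -
  define tight where "tight = (\<lambda>C. cover M C \<and> sum c C = t \<and> j \<in> C)"
  have bip': "\<exists>u v. keys g = {u, v} \<and> u \<in> - A \<and> v \<notin> - A" if "g \<in> M" for g
    using bip[OF that] by (metis ComplI Compl_iff insert_commute)
  obtain Z where Z: "tight Z" "\<And>C. tight C \<Longrightarrow> card (C - A) \<le> card (Z - A)"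
  proof -
    have "tight X" using X by (simp add: tight_def)
    moreover have "\<forall>C. tight C \<longrightarrow> card (C - A) < Suc (card (UNIV :: 'n set))"
      by (simp add: card_mono less_Suc_eq_le)
    ultimately show thesis
      using ex_has_greatest_nat[of tight X "\<lambda>C. card (C - A)"] that by blast
  qed
  have "\<exists>g v. g \<in> M \<and> keys g = {j, v} \<and> v \<notin> Z \<and> 0 < c v"
  proof (rule ccontr)
    assume none: "\<not> ?thesis"
    \<comment> \<open>If all neighbours of \<open>j\<close> outside \<open>Z\<close> had weight 0,
      they could replace \<open>j\<close> and yield a cover of weight less than
      \<open>t\<close>.\<close>
    define N where "N = {v. v \<notin> Z \<and> (\<exists>g\<in>M. keys g = {j, v})}"
    have "cover M ((Z - {j}) \<union> N)"
      unfolding cover_def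
    proof
      fix g assume g: "g \<in> M"
      obtain u v where uv: "keys g = {u, v}" "u \<in> A" "v \<notin> A" using bip[OF g] by blast
      have "u \<in> Z \<or> v \<in> Z" using Z(1) g uv(1) by (auto simp: tight_def cover_def)
      moreover have "v \<noteq> j" using uv(3) X(4) by blast
      moreover have "v \<in> N" if "u = j" "v \<notin> Z" using that g uv(1) by (auto simp: N_def)
      ultimately show "keys g \<inter> ((Z - {j}) \<union> N) \<noteq> {}" using uv(1) by auto
    qed
    then have "t \<le> sum c ((Z - {j}) \<union> N)" by (rule weight)
    also have "\<dots> = sum c (Z - {j}) + sum c N"
      by (rule sum.union_disjoint) (auto simp: N_def)
    also have "sum c N = 0" using none by (auto simp: N_def)
    also have "sum c (Z - {j}) + 0 < sum c Z"
      using Z(1) X(5) sum.remove[of Z j c] by (simp add: tight_def)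
    finally show False using Z(1) by (simp add: tight_def)
  qed
  then obtain g v where gv: "g \<in> M" "keys g = {j, v}" "v \<notin> Z" "0 < c v" by blast
  have vA: "v \<notin> A" using bip[OF gv(1)] gv(2) X(4) by (metis doubleton_eq_iff)
  have "v \<notin> C" if C: "cover M C" "sum c C = t" "j \<in> C" for C
  proof
    assume v: "v \<in> C"
    let ?J = "(Z \<inter> C \<inter> A) \<union> ((Z \<union> C) - A)" and ?L = "(Z \<inter> C \<inter> - A) \<union> ((Z \<union> C) - - A)"
    have covZ: "cover M Z" "sum c Z = t" "j \<in> Z" using Z(1) by (auto simp: tight_def)
    have J: "cover M ?J" using cover_join[OF bip covZ(1) C(1)] .
    have L: "cover M ?L" using cover_join[OF bip' covZ(1) C(1)] .
    \<comment> \<open>Join and meet together weigh \<open>2 * t\<close> and neither weighs less than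
      \<open>t\<close>, so the join is tight. It contains \<open>v\<close> and thus extends further
      outside \<open>A\<close> than \<open>Z\<close>.\<close>
    have "sum c ?J + sum c ?L = sum c (?J \<union> ?L) + sum c (?J \<inter> ?L)"
      by (rule sum.union_inter[symmetric]) auto
    also have "?J \<union> ?L = Z \<union> C" by blast
    also have "?J \<inter> ?L = Z \<inter> C" by blast
    also have "sum c (Z \<union> C) + sum c (Z \<inter> C) = sum c Z + sum c C"
      by (rule sum.union_inter) auto
    finally have "sum c ?J = t" using weight[OF J] weight[OF L] covZ(2) C(2) by linarith
    then have "tight ?J" using J C(3) covZ(3) X(4) by (simp add: tight_def)
    moreover have "Z - A \<subset> ?J - A" using v vA gv(3) by blast
    then have "card (Z - A) < card (?J - A)" by (intro psubset_card_mono) auto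
    ultimately show False using Z(2)[of ?J] by simp
  qed
  then show thesis using that gv by blast
qed

text \<open>Removing an edge lowers the weight of a cover by the number of ends it contains, at most
  2. Only covers of weight exactly \<open>Suc s\<close> containing both ends would fall below
  \<open>s\<close>. Positivity at the ends makes the truncated subtraction exact.\<close>

lemma koenig_edge:
  fixes c :: "'n::finite \<Rightarrow> nat"
  assumes bip: "\<And>g. g \<in> M \<Longrightarrow> \<exists>u v. keys g = {u, v} \<and> u \<in> A \<and> v \<notin> A"
    and weight: "\<And>C. cover M C \<Longrightarrow> Suc s \<le> sum c C"
  obtains g where "g \<in> M" "\<And>i. i \<in> keys g \<Longrightarrow> 0 < c i"
    "\<And>C. cover M C \<Longrightarrow> s \<le> (\<Sum>i\<in>C. c i - (if i \<in> keys g then 1 else 0))"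
proof -
  have "\<exists>g\<in>M. (\<forall>i\<in>keys g. 0 < c i) \<and> (\<forall>C. cover M C \<longrightarrow> sum c C = Suc s \<longrightarrow> \<not> keys g \<subseteq> C)"
  proof (cases "\<exists>X. cover M X \<and> sum c X = Suc s")
    case False
    \<comment> \<open>With no cover of weight \<open>Suc s\<close>, any edge with ends of positive
      weight will do; one exists because the vertices of weight 0 are not a cover.\<close>
    have "sum c {i. c i = 0} = 0" by simp
    then have "\<not> cover M {i. c i = 0}" using weight[of "{i. c i = 0}"] by linarith
    then obtain g where g: "g \<in> M" "keys g \<inter> {i. c i = 0} = {}" by (auto simp: cover_def)
    then have "\<forall>i\<in>keys g. 0 < c i" by auto
    then show ?thesis using False g(1) by blast
  next
    case True
    then obtain X where X: "cover M X" "sum c X = Suc s" by blast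
    then obtain j where j: "j \<in> X" "0 < c j"
      by (metis Zero_not_Suc not_gr_zero sum.neutral)
    \<comment> \<open>The two sides are interchangeable, so \<open>j\<close> may be assumed on the
      distinguished one.\<close>
    obtain B where B: "j \<in> B" "\<And>g. g \<in> M \<Longrightarrow> \<exists>u v. keys g = {u, v} \<and> u \<in> B \<and> v \<notin> B"
    proof (cases "j \<in> A")
      case True
      then show thesis using that bip by blast
    next
      case False
      have "\<exists>u v. keys g = {u, v} \<and> u \<in> - A \<and> v \<notin> - A" if "g \<in> M" for g
        using bip[OF that] by (metis ComplI Compl_iff insert_commute)
      then show thesis using that[of "- A"] False by blast
    qed
    obtain g v where "g \<in> M" "keys g = {j, v}" "0 < c v"
      "\<And>C. cover M C \<Longrightarrow> sum c C = Suc s \<Longrightarrow> j \<in> C \<Longrightarrow> v \<notin> C"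
      using koenig_edge_at[where M = M and A = B and c = c and t = "Suc s",
          OF B(2) weight X j(1) B(1) j(2)] by blast
    then show ?thesis using j(2) by (intro bexI[of _ g]) auto
  qed
  then obtain g where g: "g \<in> M" "\<And>i. i \<in> keys g \<Longrightarrow> 0 < c i"
    "\<And>C. cover M C \<Longrightarrow> sum c C = Suc s \<Longrightarrow> \<not> keys g \<subseteq> C" by blast
  have card_g: "card (keys g) = 2"
    using bip[OF g(1)] by (metis card_2_iff)
  have "s \<le> (\<Sum>i\<in>C. c i - (if i \<in> keys g then 1 else 0))" if C: "cover M C" for C
  proof -
    have "sum c C = (\<Sum>i\<in>C. (c i - (if i \<in> keys g then 1 else 0)) + (if i \<in> keys g then 1 else 0))"
      using g(2) by (intro sum.cong) (auto simp: Suc_le_eq)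
    also have "\<dots> = (\<Sum>i\<in>C. c i - (if i \<in> keys g then 1 else 0)) + card (C \<inter> keys g)"
      by (simp add: sum.distrib flip: sum.inter_restrict)
    finally have eq: "sum c C = (\<Sum>i\<in>C. c i - (if i \<in> keys g then 1 else 0)) + card (C \<inter> keys g)" .
    have le2: "card (C \<inter> keys g) \<le> 2" unfolding card_g[symmetric] by (intro card_mono) auto
    show ?thesis
    proof (cases "sum c C = Suc s")
      case True
      then have "C \<inter> keys g \<subset> keys g" using g(3)[OF C] by blast
      then have "card (C \<inter> keys g) < 2" unfolding card_g[symmetric] by (intro psubset_card_mono) auto
      then show ?thesis using eq True by linarith
    next
      case False
      then show ?thesis using eq le2 weight[OF C] by linarith
    qed
  qed
  then show thesis using that g(1,2) by blast
qed

text \<open>With \<open>c\<close> counted in units of \<open>d\<close>, each step removes one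
  generator while every cover keeps enough weight for the remaining power.\<close>

lemma weighted_bipartite_koenig:
  fixes c :: "'n::finite \<Rightarrow> nat"
  assumes bip: "\<And>g. g \<in> M \<Longrightarrow> \<exists>u v. keys g = {u, v} \<and> u \<in> A \<and> v \<notin> A"
    and d: "\<And>g i. g \<in> M \<Longrightarrow> i \<in> keys g \<Longrightarrow> lookup g i = d i"
  shows "(\<And>C. cover M C \<Longrightarrow> s \<le> sum c C) \<Longrightarrow> expvec (\<lambda>i. d i * c i) \<in> upow (upc M) s"
proof (induction s arbitrary: c)
  case (Suc s)
  obtain g where g: "g \<in> M" "\<And>i. i \<in> keys g \<Longrightarrow> 0 < c i"
    "\<And>C. cover M C \<Longrightarrow> s \<le> (\<Sum>i\<in>C. c i - (if i \<in> keys g then 1 else 0))"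
    using koenig_edge[where M = M and A = A and c = c and s = s, OF bip Suc.prems] by blast
  let ?c = "\<lambda>i. c i - (if i \<in> keys g then 1 else 0)"
  have "lookup (expvec (\<lambda>i. d i * c i)) i = lookup (g + expvec (\<lambda>i. d i * ?c i)) i" for i
  proof (cases "i \<in> keys g")
    case True
    then obtain n where "c i = Suc n" using g(2) gr0_implies_Suc by blast
    then show ?thesis using True d[OF g(1) True] by (simp add: lookup_add)
  next
    case False
    then have "lookup g i = 0" by (simp add: in_keys_iff)
    then show ?thesis using False by (simp add: lookup_add)
  qed
  then have "expvec (\<lambda>i. d i * c i) = g + expvec (\<lambda>i. d i * ?c i)" by (rule poly_mapping_eqI)
  moreover have "expvec (\<lambda>i. d i * ?c i) \<in> upow (upc M) s" using Suc.IH[of ?c] g(3) by blast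
  moreover have "g \<in> upc M" using g(1) subset_upc by blast
  ultimately show ?case by auto
qed simp

text \<open>Each of the \<open>s\<close> factors contributes a full \<open>d i\<close> at some
  \<open>i\<close> in \<open>C\<close>, hence 1 to the quotient, and rounding down is
  superadditive.\<close>

lemma weighted_cover_weight:
  fixes M :: "('n::finite \<Rightarrow>\<^sub>0 nat) set"
  assumes d: "\<And>i. 0 < d i" "\<And>g i. g \<in> M \<Longrightarrow> i \<in> keys g \<Longrightarrow> lookup g i = d i"
    and C: "cover M C"
  shows "u \<in> upow (upc M) s \<Longrightarrow> s \<le> (\<Sum>i\<in>C. lookup u i div d i)"
proof (induction s arbitrary: u)
  case (Suc s)
  then obtain a b where ab: "u = a + b" "a \<in> upc M" "b \<in> upow (upc M) s" by auto
  then obtain g where g: "g \<in> M" "mdvd g a" by (auto simp: upc_def)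
  obtain i where i: "i \<in> keys g" "i \<in> C" using C g(1) by (auto simp: cover_def)
  have "d i \<le> lookup a i" using d(2)[OF g(1) i(1)] g(2) by (metis mdvd_def)
  then have "1 \<le> lookup a i div d i" using d(1)[of i] by (simp add: Suc_le_eq div_greater_zero_iff)
  also have "\<dots> \<le> (\<Sum>i\<in>C. lookup a i div d i)" using i(2) by (intro member_le_sum) auto
  finally have "Suc s \<le> (\<Sum>i\<in>C. lookup a i div d i) + (\<Sum>i\<in>C. lookup b i div d i)"
    using Suc.IH[OF ab(3)] by linarith
  also have "\<dots> = (\<Sum>i\<in>C. lookup a i div d i + lookup b i div d i)" by (simp add: sum.distrib)
  also have "\<dots> \<le> (\<Sum>i\<in>C. lookup u i div d i)"
  proof (rule sum_mono)
    fix i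
    show "lookup a i div d i + lookup b i div d i \<le> lookup u i div d i"
      using div_add1_eq[of "lookup a i" "lookup b i" "d i"] by (simp add: ab(1) lookup_add)
  qed
  finally show ?case .
qed simp

text \<open>Rounding \<open>a\<close> down to multiples of \<open>d\<close> preserves the cover
  inequalities that localisation gives. The rounded monomial lies in the ordinary power and divides
  the given one.\<close>

lemma simis_weighted_bipartite:
  fixes M :: "('n::finite \<Rightarrow>\<^sub>0 nat) set"
  assumes bip: "bipartite (keys ` M)"
    and d: "\<And>i. 0 < d i" "\<And>g i. g \<in> M \<Longrightarrow> i \<in> keys g \<Longrightarrow> lookup g i = d i"
  shows "simis (mideal (upc M) :: ('n, 'k::field) mpoly set)"
  unfolding simis_mideal
proof (intro allI impI)
  fix s a
  assume loc: "\<forall>C. min_cover M C \<longrightarrow> a \<in> loc C (upow (upc M) s)"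
  obtain A where "\<forall>e\<in>keys ` M. \<exists>u v. e = {u, v} \<and> u \<in> A \<and> v \<notin> A"
    using bip unfolding bipartite_def by blast
  then have A: "\<exists>u v. keys g = {u, v} \<and> u \<in> A \<and> v \<notin> A" if "g \<in> M" for g
    using that by blast
  have "s \<le> (\<Sum>i\<in>C. lookup a i div d i)" if C: "cover M C" for C
  proof -
    obtain D where D: "min_cover M D" "D \<subseteq> C" using exists_min_cover_subset[OF C] .
    then obtain y where y: "keys y \<inter> D = {}" "a + y \<in> upow (upc M) s"
      using loc by (auto simp: loc_def)
    have "s \<le> (\<Sum>i\<in>D. lookup (a + y) i div d i)"
      using weighted_cover_weight[of d M D, OF d _ y(2)] D(1) by (simp add: min_cover_def)
    also have "\<dots> = (\<Sum>i\<in>D. lookup a i div d i)"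
    proof (rule sum.cong[OF refl])
      fix i assume "i \<in> D"
      then have "i \<notin> keys y" using y(1) by blast
      then show "lookup (a + y) i div d i = lookup a i div d i"
        by (simp add: lookup_add not_in_keys_iff_lookup_eq_zero)
    qed
    also have "\<dots> \<le> (\<Sum>i\<in>C. lookup a i div d i)" using D(2) by (intro sum_mono2) auto
    finally show ?thesis .
  qed
  then have "expvec (\<lambda>i. d i * (lookup a i div d i)) \<in> upow (upc M) s"
    using weighted_bipartite_koenig[OF A d(2)] by blast
  moreover have "mdvd (expvec (\<lambda>i. d i * (lookup a i div d i))) a" by (simp add: mdvd_def)
  ultimately show "a \<in> upow (upc M) s" using upsetD[OF upset_upow] by blast
qed

section \<open>Support-2 monomial ideals\<close>

text \<open>In an antichain on one edge either exponent determines the generator, and compared with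
  a fixed \<open>g\<close> one of the two exponents does not exceed that of
  \<open>g\<close>.\<close>

lemma finite_support2_antichain:
  fixes M :: "('n::finite \<Rightarrow>\<^sub>0 nat) set"
  assumes supp: "\<And>g. g \<in> M \<Longrightarrow> \<exists>i j. i \<noteq> j \<and> keys g = {i, j}"
    and anti: "\<And>g h. g \<in> M \<Longrightarrow> h \<in> M \<Longrightarrow> mdvd g h \<Longrightarrow> g = h"
  shows "finite M"
proof -
  have "finite {f \<in> M. keys f = {i, j}}" (is "finite ?S") for i j
  proof (cases "?S = {}")
    case False
    then obtain g where g: "g \<in> ?S" by blast
    have mdvd_S: "f = f'"
      if "f \<in> ?S" "f' \<in> ?S" "lookup f i \<le> lookup f' i" "lookup f j \<le> lookup f' j" for f f'
    proof -
      have "lookup f v \<le> lookup f' v" for v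
      proof (cases "v \<in> {i, j}")
        case False
        then have "v \<notin> keys f" using that(1) by simp
        then show ?thesis by (simp add: in_keys_iff)
      qed (use that in auto)
      then show ?thesis using anti that by (simp add: mdvd_def)
    qed
    have inj: "f = f'" if "f \<in> ?S" "f' \<in> ?S" "lookup f i = lookup f' i \<or> lookup f j = lookup f' j" for f f'
    proof (cases "lookup f i \<le> lookup f' i \<and> lookup f j \<le> lookup f' j")
      case True
      then show ?thesis using mdvd_S[OF that(1,2)] by blast
    next
      case False
      then have "lookup f' i \<le> lookup f i" "lookup f' j \<le> lookup f j" using that(3) by linarith+
      then show ?thesis using mdvd_S[OF that(2,1)] by simp
    qed
    have "finite {f \<in> ?S. lookup f i \<le> lookup g i}"
      using inj by (intro inj_on_finite[where B = "{..lookup g i}" and f = "\<lambda>f. lookup f i"] inj_onI) auto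
    moreover have "finite {f \<in> ?S. lookup f j \<le> lookup g j}"
      using inj by (intro inj_on_finite[where B = "{..lookup g j}" and f = "\<lambda>f. lookup f j"] inj_onI) auto
    moreover have "?S \<subseteq> {f \<in> ?S. lookup f i \<le> lookup g i} \<union> {f \<in> ?S. lookup f j \<le> lookup g j}"
    proof
      fix f assume f: "f \<in> ?S"
      show "f \<in> {f \<in> ?S. lookup f i \<le> lookup g i} \<union> {f \<in> ?S. lookup f j \<le> lookup g j}"
      proof (rule ccontr)
        assume "\<not> ?thesis"
        then have "\<not> lookup f i \<le> lookup g i" "\<not> lookup f j \<le> lookup g j" using f by blast+
        then show False using mdvd_S[OF g f] by simp
      qed
    qed
    ultimately show ?thesis by (meson finite_UnI finite_subset)
  qed (simp only: finite.emptyI)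
  then have "finite (\<Union>i\<in>UNIV. \<Union>j\<in>UNIV. {f \<in> M. keys f = {i, j}})"
    by (intro finite_UN_I[OF finite])
  moreover have "M \<subseteq> (\<Union>i\<in>UNIV. \<Union>j\<in>UNIV. {f \<in> M. keys f = {i, j}})"
  proof
    fix g assume g: "g \<in> M"
    then obtain i j where "keys g = {i, j}" using supp by blast
    then show "g \<in> (\<Union>i\<in>UNIV. \<Union>j\<in>UNIV. {f \<in> M. keys f = {i, j}})"
      using g by (intro UN_I[of i] UN_I[of j]) simp_all
  qed
  ultimately show ?thesis by (rule rev_finite_subset)
qed

section \<open>Square-free vectors and the radical of a support-2 ideal\<close>

definition sqfree_vec :: "'n::finite set \<Rightarrow> ('n \<Rightarrow>\<^sub>0 nat)" where
  "sqfree_vec e = expvec (\<lambda>i. if i \<in> e then 1 else 0)"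

lemma lookup_sqfree_vec [simp]: "lookup (sqfree_vec e) i = (if i \<in> e then 1 else 0)"
  by (simp add: sqfree_vec_def)

lemma keys_sqfree_vec [simp]: "keys (sqfree_vec e) = e"
  by (auto simp: sqfree_vec_def)

lemma lookup_wvec [simp]: "lookup (wvec d a) i = d i * lookup a i"
  by (simp add: wvec_def lookup_mapp when_def in_keys_iff)

lemma keys_wvec: "std_weighting d \<Longrightarrow> keys (wvec d a) = keys a"
  by (auto simp: std_weighting_def in_keys_iff)

lemma upset_keys_superset: "upset {a. \<exists>m\<in>M. keys m \<subseteq> keys a}"
  unfolding upset_def by (auto intro: le_supI1)

text \<open>All supports have two elements, so none properly contains another and each gives a
  minimal generator.\<close>

lemma mingens_radical:
  fixes M :: "('n::finite \<Rightarrow>\<^sub>0 nat) set"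
  assumes supp: "\<And>g. g \<in> M \<Longrightarrow> \<exists>i j. i \<noteq> j \<and> keys g = {i, j}"
  shows "mingens (radical (mideal (upc M) :: ('n, 'k::field) mpoly set)) = sqfree_vec ` keys ` M"
  unfolding radical_mideal mingens_mideal
proof (intro equalityI subsetI)
  fix a assume "a \<in> {a \<in> {a. \<exists>m\<in>M. keys m \<subseteq> keys a}.
    \<forall>b\<in>{a. \<exists>m\<in>M. keys m \<subseteq> keys a}. mdvd b a \<longrightarrow> b = a}"
  then have "\<exists>m\<in>M. keys m \<subseteq> keys a"
    and min: "\<And>b. \<exists>m\<in>M. keys m \<subseteq> keys b \<Longrightarrow> mdvd b a \<Longrightarrow> b = a" by simp_all
  then obtain m where m: "m \<in> M" "keys m \<subseteq> keys a" by blast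
  have "mdvd (sqfree_vec (keys m)) a"
    unfolding mdvd_def
  proof
    fix i
    show "lookup (sqfree_vec (keys m)) i \<le> lookup a i"
    proof (cases "i \<in> keys m")
      case True
      then have "i \<in> keys a" using m(2) by blast
      then show ?thesis by (simp add: in_keys_iff Suc_le_eq)
    qed simp
  qed
  then have "sqfree_vec (keys m) = a" using min[of "sqfree_vec (keys m)"] m(1) by auto
  then show "a \<in> sqfree_vec ` keys ` M" using m(1) by blast
next
  fix a assume "a \<in> sqfree_vec ` keys ` M"
  then obtain m where m: "m \<in> M" "a = sqfree_vec (keys m)" by blast
  have "b = a" if b: "m' \<in> M" "keys m' \<subseteq> keys b" "mdvd b a" for b m'
  proof (rule poly_mapping_eqI)
    fix i
    have le: "lookup b v \<le> (if v \<in> keys m then 1 else 0)" for v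
      using b(3) m(2) by (simp add: mdvd_def)
    then have sub: "keys b \<subseteq> keys m" by (force simp: in_keys_iff split: if_splits)
    have "card (keys m') = 2" "card (keys m) = 2"
      using supp b(1) m(1) by (metis card_2_iff)+
    then have "keys m' = keys m" using b(2) sub by (intro card_subset_eq) auto
    then have "keys b = keys m" using b(2) sub by blast
    then show "lookup b i = lookup a i"
      using le[of i] m(2) by (cases "i \<in> keys m") (auto simp: in_keys_iff le_Suc_eq)
  qed
  then show "a \<in> {a \<in> {a. \<exists>m\<in>M. keys m \<subseteq> keys a}.
      \<forall>b\<in>{a. \<exists>m\<in>M. keys m \<subseteq> keys a}. mdvd b a \<longrightarrow> b = a}" using m by auto
qed

theorem theorem2p3:
  fixes I :: "('n::finite, 'k::field) mpoly set"
  assumes "monomial_ideal I"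
    and "support2 I"
    and "minimal_irr_decomp I"
    and "Ass I \<subseteq> MinAss I"
  shows "(simis I \<longleftrightarrow> bipartite (graph_edges I) \<and> has_std_weighting I)
    \<and> (simis I \<longrightarrow> (\<exists>(J :: ('n, 'k) mpoly set) d. squarefree_monomial_ideal J \<and> simis J
          \<and> std_weighting d \<and> I = weighted d J))"
proof -
  define M where "M = mingens I"
  have I: "I = mideal (upc M)" using monomial_ideal_eq_mideal[OF assms(1)] by (simp add: M_def)
  have supp: "\<exists>i j. i \<noteq> j \<and> keys g = {i, j}" if "g \<in> M" for g
    using assms(2) that by (simp add: support2_def M_def)
  have anti: "g = h" if "g \<in> M" "h \<in> M" "mdvd g h" for g h
    using that unfolding M_def mingens_def by blast
  have fin: "finite M" using finite_support2_antichain[of M, OF supp anti] by blast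
  have rad: "mingens (radical I) = sqfree_vec ` keys ` M"
    unfolding I by (rule mingens_radical[OF supp])
  have edges: "graph_edges I = keys ` M" by (simp add: graph_edges_def M_def)
  have fwd: "bipartite (keys ` M) \<and> (\<exists>d. std_weighting d \<and> I = weighted d (radical I))"
    if "simis I"
  proof -
    interpret simis_exponents M
    proof
      show "finite M" by (rule fin)
      show "\<exists>i j. i \<noteq> j \<and> keys g = {i, j}" if "g \<in> M" for g by (rule supp[OF that])
      show "g = h" if "g \<in> M" "h \<in> M" "mdvd g h" for g h by (rule anti[OF that])
      show "locally_irreducible M"
        using minimal_irr_decomp_imp_locally_irreducible[OF fin] assms(3) I by blast
      show "a \<in> upow (upc M) s"
        if "1 \<le> s" "\<And>C. min_cover M C \<Longrightarrow> a \<in> loc C (upow (upc M) s)" for s a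
        using \<open>simis I\<close> that unfolding I simis_mideal by blast
    qed
    obtain d where d: "\<And>i. 0 < d i" "\<And>g i. g \<in> M \<Longrightarrow> i \<in> keys g \<Longrightarrow> lookup g i = d i"
      "bipartite (keys ` M)" using weighting_and_bipartite by blast
    \<comment> \<open>Exponents depend on the vertex alone, so weighting the support of a generator
      gives the generator back.\<close>
    have "wvec d (sqfree_vec (keys g)) = g" if "g \<in> M" for g
      using d(2)[OF that] by (intro poly_mapping_eqI) (simp add: not_in_keys_iff_lookup_eq_zero)
    then have "wvec d ` mingens (radical I) = M" by (simp add: rad image_image)
    then have "I = weighted d (radical I)" unfolding weighted_def ideal_gen_monom using I by simp
    moreover have "std_weighting d" using d(1) by (simp add: std_weighting_def)
    ultimately show ?thesis using d(3) by blast
  qed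
  have bwd: "simis I" if "bipartite (keys ` M)" "std_weighting d" "I = weighted d (radical I)" for d
  proof -
    \<comment> \<open>Weighting preserves supports, so the bipartition of the graph carries over to
      these generators.\<close>
    let ?N = "wvec d ` sqfree_vec ` keys ` M"
    have "simis (mideal (upc ?N) :: ('n, 'k) mpoly set)"
    proof (rule simis_weighted_bipartite[of _ d])
      show "bipartite (keys ` ?N)" using that(1) by (simp add: image_image keys_wvec[OF that(2)])
    qed (use that(2) in \<open>auto simp: std_weighting_def in_keys_iff split: if_splits\<close>)
    then show ?thesis
      using that(3) by (simp add: weighted_def ideal_gen_monom rad)
  qed
  \<comment> \<open>The radical serves as \<open>J\<close>: it has the same graph, and the bipartite
    criterion applies with all weights 1.\<close>
  have J: "squarefree_monomial_ideal (radical I) \<and> simis (radical I)" if "bipartite (keys ` M)"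
  proof
    have mono: "monomial_ideal (radical I)"
      unfolding I radical_mideal by (rule monomial_ideal_mideal[OF upset_keys_superset])
    then show "squarefree_monomial_ideal (radical I)"
      unfolding squarefree_monomial_ideal_def rad by simp
    have "simis (mideal (upc (sqfree_vec ` keys ` M)) :: ('n, 'k) mpoly set)"
      using that by (intro simis_weighted_bipartite[of _ "\<lambda>_. 1"]) (auto simp: image_image)
    then show "simis (radical I)" using monomial_ideal_eq_mideal[OF mono] by (simp add: rad)
  qed
  show ?thesis
    unfolding edges has_std_weighting_def using fwd bwd J by blast
qed

end
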